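(* Let $(X,\sigma_X)$ be a subshift and $\mathcal F=\{\log f_n\}_{n=1}^\infty$ a subadditive sequence on $X$. For $h\in C(X)$, the following conditions are equivalent. (i) $\lim_{n\to\infty}\frac1n\int\log f_n\,d\mu=\int h\,d\mu$ for every $\mu\in M(X,\sigma_X)$. (ii) $\lim_{n\to\infty}\frac1n\int\log f_n\,d\mu=\int h\,d\mu$ for every $\mu\in \mathrm{Erg}(X,\sigma_X)$. (iii) $\lim_{n\to\infty}\frac1n\log\left(\frac{f_n(x)}{e^{(S_nh)(x)}}\right)=0$ for $\mu$-almost every $x\in X$, for every $\mu\in \mathrm{Erg}(X,\sigma_X)$.
   Context: A (one-sided) subshift $(X,\sigma_X)$ is a closed set $X\subseteq\{1,\dots,k\}^{\mathbb N}$ (some $k\ge1$, $\mathbb N=\{1,2,\dots\}$) with $\sigma_X(X)\subseteq X$, where $(\sigma_Xx)_i=x_{i+1}$. $M(X,\sigma_X)$ is the set of $\sigma_X$-invariant Borel probability measures on $X$, and $\mathrm{Erg}(X,\sigma_X)$ the set of its ergodic members. $(S_nh)(x)=\sum_{i=0}^{n-1}h(\sigma_X^ix)$. A sequence $\mathcal F=\{\log f_n\}_{n=1}^\infty$ on $X$ consists of continuous functions $f_n:X\to(0,\infty)$; it is subadditive if $f_{n+m}(x)\le f_n(x)f_m(\sigma_X^nx)$ for all $n,m\in\mathbb N$ and $x\in X$. *)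

theory Defs
  imports "HOL-Probability.Probability"
begin

text \<open>
  Sequences are indexed from 0 instead of 1. The type \<^typ>\<open>nat \<Rightarrow> nat\<close> carries the product
  topology of the discrete topologies, and \<^term>\<open>borel\<close> is its Borel sigma-algebra.
\<close>

definition shift_map :: "(nat \<Rightarrow> 'a) \<Rightarrow> (nat \<Rightarrow> 'a)" where
  "shift_map x = (\<lambda>i. x (Suc i))"

definition subshift :: "(nat \<Rightarrow> nat) set \<Rightarrow> bool" where
  "subshift X \<longleftrightarrow>
     (\<exists>k\<ge>1. X \<subseteq> {x. \<forall>i. x i \<in> {1..k}}) \<and> closed X \<and> shift_map ` X \<subseteq> X"

definition invariant_measures :: "(nat \<Rightarrow> nat) set \<Rightarrow> (nat \<Rightarrow> nat) measure set" where
  "invariant_measures X =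
     {\<mu>. prob_space \<mu> \<and> sets \<mu> = sets (restrict_space borel X) \<and>
         (\<forall>A\<in>sets \<mu>. emeasure \<mu> (shift_map -` A \<inter> X) = emeasure \<mu> A)}"

definition ergodic_measures :: "(nat \<Rightarrow> nat) set \<Rightarrow> (nat \<Rightarrow> nat) measure set" where
  "ergodic_measures X =
     {\<mu> \<in> invariant_measures X.
        \<forall>A\<in>sets \<mu>. shift_map -` A \<inter> X = A \<longrightarrow> emeasure \<mu> A = 0 \<or> emeasure \<mu> A = 1}"

definition birkhoff_sum :: "nat \<Rightarrow> ((nat \<Rightarrow> 'a) \<Rightarrow> real) \<Rightarrow> (nat \<Rightarrow> 'a) \<Rightarrow> real" where
  "birkhoff_sum n h x = (\<Sum>i<n. h ((shift_map ^^ i) x))"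

text \<open>
  A sequence \<open>(log f\<^sub>n)\<close>, \<open>n \<ge> 1\<close>, is represented by the functions \<open>f\<^sub>n\<close>; the value \<open>f 0\<close>
  and the values off \<open>X\<close> are unconstrained.
\<close>

definition subadditive_sequence ::
  "(nat \<Rightarrow> nat) set \<Rightarrow> (nat \<Rightarrow> (nat \<Rightarrow> nat) \<Rightarrow> real) \<Rightarrow> bool" where
  "subadditive_sequence X f \<longleftrightarrow>
     (\<forall>n\<ge>1. continuous_on X (f n) \<and> (\<forall>x\<in>X. f n x > 0)) \<and>
     (\<forall>n\<ge>1. \<forall>m\<ge>1. \<forall>x\<in>X. f (n + m) x \<le> f n x * f m ((shift_map ^^ n) x))"

end

theory Submission imports Defs begin

text \<open>
  Put \<open>g\<^sub>n = log f\<^sub>n - S\<^sub>n h\<close>, a subadditive sequence of bounded continuous functions; the three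
  conditions say that \<open>g\<^sub>n / n\<close> tends to \<open>0\<close>, in mean for all invariant measures, in mean for
  the ergodic ones, and almost everywhere for the ergodic ones.

  For an ergodic measure the last two are equivalent by Kingman's theorem: averaging over blocks of
  length \<open>N\<close> bounds the upper limit of \<open>g\<^sub>n / n\<close> by \<open>(\<integral>g\<^sub>N) / N\<close>, and a stopping time argument
  bounds the lower limit from below by the limit of the means. The latter, applied to an additive
  sequence, also contains the case of Birkhoff's theorem that the former needs.

  To pass from ergodic to all invariant measures no ergodic decomposition is needed. If the means
  of \<open>g\<^sub>n / n\<close> under some invariant measure are all at least \<open>c\<close>, then the measures maximising the
  infimum of these means form a nonempty closed face of the compact convex set of invariant
  measures, and an extreme point of this face is an ergodic measure whose means are all at least
  \<open>c\<close>. This excludes positive limits; applied to the additive sequences generated by \<open>- g\<^sub>N\<close>, it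
  excludes negative ones.
\<close>

section \<open>Subadditive processes\<close>

lemma orbit_sum_add:
  fixes \<phi> :: "'a \<Rightarrow> 'b::comm_monoid_add"
  shows "(\<Sum>i<n + m. \<phi> ((T ^^ i) x)) = (\<Sum>i<n. \<phi> ((T ^^ i) x)) + (\<Sum>i<m. \<phi> ((T ^^ i) ((T ^^ n) x)))"
proof (induction m)
  case (Suc m)
  have "(T ^^ m) ((T ^^ n) x) = (T ^^ (n + m)) x"
    by (simp add: add.commute[of n m] funpow_add)
  with Suc show ?case by (simp add: add.assoc)
qed simp

section \<open>Measure-preserving maps and estimates for subadditive processes\<close>

locale measure_preserving_map = prob_space M for M :: "'a measure" +
  fixes T :: "'a \<Rightarrow> 'a"
  assumes T_measurable [measurable]: "T \<in> M \<rightarrow>\<^sub>M M"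
    and T_invariant: "A \<in> sets M \<Longrightarrow> emeasure M (T -` A \<inter> space M) = emeasure M A"
begin

lemma iterate_measurable [measurable]: "T ^^ n \<in> M \<rightarrow>\<^sub>M M"
  by (rule measurable_compose_n) (rule T_measurable)

lemma iterate_space: "x \<in> space M \<Longrightarrow> (T ^^ n) x \<in> space M"
  using measurable_space[OF iterate_measurable] .

lemma distr_T: "distr M M T = M"
  by (rule measure_eqI) (auto simp: emeasure_distr T_invariant)

lemma distr_iterate: "distr M M (T ^^ n) = M"
proof (induction n)
  case 0
  then show ?case by (simp add: distr_id id_def)
next
  case (Suc n)
  have "distr M M (T ^^ Suc n) = distr (distr M M (T ^^ n)) M T"
    by (subst distr_distr) (auto simp: comp_def)
  then show ?case
    by (simp only: Suc distr_T)
qed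

lemma integral_iterate:
  fixes \<phi> :: "'a \<Rightarrow> real"
  assumes "\<phi> \<in> borel_measurable M"
  shows "(\<integral>x. \<phi> ((T ^^ n) x) \<partial>M) = (\<integral>x. \<phi> x \<partial>M)"
proof -
  have "(\<integral>x. \<phi> x \<partial>distr M M (T ^^ n)) = (\<integral>x. \<phi> ((T ^^ n) x) \<partial>M)"
    using assms by (intro integral_distr) auto
  then show ?thesis
    by (simp add: distr_iterate)
qed

lemma emeasure_iterate_vimage:
  assumes "A \<in> sets M"
  shows "emeasure M ((T ^^ n) -` A \<inter> space M) = emeasure M A"
  using emeasure_distr[OF iterate_measurable assms, of n] by (simp add: distr_iterate)

lemma integral_orbit_sum:
  fixes \<phi> :: "'a \<Rightarrow> real"
  assumes [measurable]: "\<phi> \<in> borel_measurable M" and bd: "\<And>x. x \<in> space M \<Longrightarrow> \<bar>\<phi> x\<bar> \<le> C"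
  shows "(\<integral>x. (\<Sum>i<n. \<phi> ((T ^^ i) x)) \<partial>M) = real n * (\<integral>x. \<phi> x \<partial>M)"
proof -
  have "integrable M (\<lambda>x. \<phi> ((T ^^ i) x))" for i
    by (rule integrable_const_bound[where B=C]) (auto intro!: AE_I2 bd iterate_space)
  then show ?thesis
    by (simp add: Bochner_Integration.integral_sum integral_iterate)
qed

end

text \<open>The processes in view consist of continuous functions on a compact space, so each
  \<open>g n\<close> is taken bounded, with no uniformity in \<open>n\<close>. Normalising
  \<open>g 0\<close> to zero lets subadditivity be stated for all indices and inductions start at
  zero.\<close>

locale subadditive_process = measure_preserving_map +
  fixes g :: "nat \<Rightarrow> 'a \<Rightarrow> real"
  assumes g_measurable [measurable]: "g n \<in> borel_measurable M"
    and g_bounded: "\<exists>C. \<forall>x\<in>space M. \<bar>g n x\<bar> \<le> C"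
    and g_zero: "x \<in> space M \<Longrightarrow> g 0 x = 0"
    and g_subadd: "x \<in> space M \<Longrightarrow> g (n + m) x \<le> g n x + g m ((T ^^ n) x)"
begin

lemma g_integrable: "integrable M (g n)"
proof -
  obtain C where "\<forall>x\<in>space M. \<bar>g n x\<bar> \<le> C"
    using g_bounded by blast
  then show ?thesis
    by (intro integrable_const_bound[where B=C]) auto
qed

lemma integral_g_zero: "(\<integral>x. g 0 x \<partial>M) = 0"
  using Bochner_Integration.integral_cong[OF refl g_zero] by simp

lemma common_bound:
  obtains C where "0 \<le> C" and "\<And>n x. n < k \<Longrightarrow> x \<in> space M \<Longrightarrow> \<bar>g n x\<bar> \<le> C"
proof -
  obtain D where D: "\<And>n x. x \<in> space M \<Longrightarrow> \<bar>g n x\<bar> \<le> D n"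
    using g_bounded by metis
  show ?thesis
  proof
    show "0 \<le> (\<Sum>n<k. \<bar>D n\<bar>)"
      by (simp add: sum_nonneg)
    fix n x assume "n < k" "x \<in> space M"
    then have "\<bar>D n\<bar> \<le> (\<Sum>n<k. \<bar>D n\<bar>)"
      by (intro member_le_sum) auto
    with D[OF \<open>x \<in> space M\<close>, of n] show "\<bar>g n x\<bar> \<le> (\<Sum>n<k. \<bar>D n\<bar>)"
      by linarith
  qed
qed

lemma g_le_linear:
  assumes "\<And>x. x \<in> space M \<Longrightarrow> g 1 x \<le> C" and "x \<in> space M"
  shows "g n x \<le> real n * C"
  using assms(2)
proof (induction n arbitrary: x)
  case 0
  then show ?case by (simp add: g_zero)
next
  case (Suc n)
  have "g (1 + n) x \<le> g 1 x + g n ((T ^^ 1) x)"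
    by (rule g_subadd) fact
  also have "\<dots> \<le> C + real n * C"
    by (intro add_mono assms(1) Suc iterate_space)
  finally show ?case
    by (simp add: algebra_simps)
qed

lemma g_multiple_le:
  assumes "x \<in> space M"
  shows "g (q * N) x \<le> (\<Sum>l<q. g N ((T ^^ (l * N)) x))"
proof (induction q)
  case 0
  then show ?case using assms by (simp add: g_zero)
next
  case (Suc q)
  have "g (q * N + N) x \<le> g (q * N) x + g N ((T ^^ (q * N)) x)"
    by (rule g_subadd) fact
  with Suc show ?case
    by (simp add: add.commute)
qed

text \<open>
  Cut \<open>{0..<n}\<close> into blocks of length \<open>N\<close> after an initial segment of length \<open>j < N\<close>, and average
  over \<open>j\<close>: every starting point of a block is then used exactly once.
\<close>

lemma g_le_average:
  obtains K where "\<And>n x. x \<in> space M \<Longrightarrow>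
    real N * g n x \<le> (\<Sum>i<n. g N ((T ^^ i) x)) + K"
proof -
  \<comment> \<open>The pieces left over at both ends have lengths \<open>j < N\<close> and
    \<open>N + s - j < 2 * N\<close>, and \<open>g N\<close> itself is estimated too; one bound
    \<open>D\<close> covers all these indices.\<close>
  obtain D where D0: "0 \<le> D" and D: "\<And>n x. n < 2 * N + 1 \<Longrightarrow> x \<in> space M \<Longrightarrow> \<bar>g n x\<bar> \<le> D"
    using common_bound[of "2 * N + 1"] by metis
  \<comment> \<open>Half of \<open>4 * N * D\<close> pays for the two end pieces at each of the
    \<open>N\<close> offsets. The other half pays for extending the orbit sum from
    \<open>q * N\<close> to \<open>n\<close>, by fewer than \<open>2 * N\<close> terms that are each
    at least \<open>- D\<close>.\<close>
  have "real N * g n x \<le> (\<Sum>i<n. g N ((T ^^ i) x)) + 4 * N * D" if x: "x \<in> space M" for n x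
  proof (cases "n < N \<or> N = 0")
    case True
    have "real N * g n x \<le> real N * D"
    proof (cases "N = 0")
      case False
      then have "\<bar>g n x\<bar> \<le> D" using True x by (intro D) auto
      then show ?thesis by (intro mult_left_mono) auto
    qed simp
    moreover have "(\<Sum>i<n. g N ((T ^^ i) x)) \<ge> - (real N * D)"
    proof (cases "N = 0")
      case True
      then show ?thesis using x by (simp add: g_zero iterate_space)
    next
      case False
      have "- (real N * D) \<le> - (real n * D)"
        using True False D0 by (simp add: mult_right_mono)
      also have "\<dots> = (\<Sum>i<n. - D)" by simp
      also have "\<dots> \<le> (\<Sum>i<n. g N ((T ^^ i) x))"
        using D[of N "(T ^^ i) x" for i] iterate_space[OF x] by (intro sum_mono) (simp add: abs_le_iff minus_le_iff)
      finally show ?thesis .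
    qed
    moreover have "0 \<le> real N * D" using D0 by simp
    ultimately show ?thesis by linarith
  next
    case False
    then have N: "0 < N" "N \<le> n" by auto
    \<comment> \<open>One full block is given up, so that \<open>q\<close> blocks fit after every
      offset \<open>j < N\<close> and the same \<open>q\<close> serves all offsets.\<close>
    define q where "q = n div N - 1"
    define s where "s = n mod N"
    have "1 \<le> n div N" using N by (simp add: Suc_leI div_greater_zero_iff)
    then have n: "n = q * N + N + s"
      using div_mult_mod_eq[of n N] unfolding q_def s_def by (cases "n div N") auto
    have s: "s < N" using N by (simp add: s_def)
    have *: "g n x \<le> 2 * D + (\<Sum>l<q. g N ((T ^^ (l * N + j)) x))" if j: "j < N" for j
    proof -
      have "g n x = g (j + (q * N + (N + s - j))) x"
        using n j by (intro arg_cong[where f="\<lambda>n. g n x"]) simp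
      also have "\<dots> \<le> g j x + g (q * N + (N + s - j)) ((T ^^ j) x)"
        by (rule g_subadd) fact
      also have "g (q * N + (N + s - j)) ((T ^^ j) x)
          \<le> g (q * N) ((T ^^ j) x) + g (N + s - j) ((T ^^ (q * N)) ((T ^^ j) x))"
        by (intro g_subadd iterate_space x)
      also have "g (q * N) ((T ^^ j) x) \<le> (\<Sum>l<q. g N ((T ^^ (l * N)) ((T ^^ j) x)))"
        by (intro g_multiple_le iterate_space x)
      also have "g (N + s - j) ((T ^^ (q * N)) ((T ^^ j) x)) \<le> D"
        using D[of "N + s - j" "(T ^^ (q * N)) ((T ^^ j) x)"] s
          iterate_space[OF iterate_space[OF x], of "q * N" j] by (simp add: abs_le_iff)
      also have "g j x \<le> D"
        using D[of j x] j x by auto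
      finally show ?thesis
        by (simp add: funpow_add)
    qed
    have "real N * g n x = (\<Sum>j<N. g n x)"
      by simp
    also have "\<dots> \<le> (\<Sum>j<N. 2 * D + (\<Sum>l<q. g N ((T ^^ (l * N + j)) x)))"
      by (intro sum_mono *) auto
    also have "\<dots> = 2 * N * D + (\<Sum>l<q. \<Sum>j<N. g N ((T ^^ (l * N + j)) x))"
      by (simp add: sum.distrib) (rule sum.swap)
    also have "(\<Sum>l<q. \<Sum>j<N. g N ((T ^^ (l * N + j)) x))
        = (\<Sum>l<q. \<Sum>i\<in>{l * N..<l * N + N}. g N ((T ^^ i) x))"
      using sum.atLeastLessThan_shift_0[of "\<lambda>i. g N ((T ^^ i) x)" "l * N" "l * N + N" for l]
      by (simp add: lessThan_atLeast0 comp_def)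
    also have "\<dots> = (\<Sum>i<q * N. g N ((T ^^ i) x))"
      by (rule sum.nat_group)
    also have "\<dots> \<le> (\<Sum>i<n. g N ((T ^^ i) x)) + 2 * N * D"
    proof -
      have "(\<Sum>i<n. g N ((T ^^ i) x)) = (\<Sum>i<q * N. g N ((T ^^ i) x)) + (\<Sum>i\<in>{q * N..<n}. g N ((T ^^ i) x))"
        using n by (simp add: lessThan_atLeast0 sum.atLeastLessThan_concat)
      moreover have "(\<Sum>i\<in>{q * N..<n}. g N ((T ^^ i) x)) \<ge> (\<Sum>i\<in>{q * N..<n}. - D)"
        using D[of N "(T ^^ i) x" for i] iterate_space[OF x]
        by (intro sum_mono) (simp add: abs_le_iff minus_le_iff)
      moreover have "(\<Sum>i\<in>{q * N..<n}. - D) = - (real (N + s) * D)"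
        using n by simp
      moreover have "real (N + s) * D \<le> real (2 * N) * D"
        using s D0 by (intro mult_right_mono) auto
      ultimately show ?thesis by linarith
    qed
    finally show ?thesis by (simp add: mult_ac)
  qed
  then show ?thesis using that by blast
qed

text \<open>Integrating the block estimate and using invariance leaves an error
  \<open>K / (N * n)\<close>, which vanishes. This is the half of Fekete's lemma needed below: one
  small mean forces all later ones down.\<close>

lemma mean_le_average:
  assumes "1 \<le> N" and "0 < \<delta>"
  shows "\<forall>\<^sub>F n in sequentially. (\<integral>x. g n x \<partial>M) / n < (\<integral>x. g N x \<partial>M) / N + \<delta>"
proof -
  obtain K where K: "\<And>n x. x \<in> space M \<Longrightarrow> real N * g n x \<le> (\<Sum>i<n. g N ((T ^^ i) x)) + K"
    using g_le_average[of N] by metis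
  obtain C where C: "\<And>x. x \<in> space M \<Longrightarrow> \<bar>g N x\<bar> \<le> C"
    using g_bounded by blast
  have int: "integrable M (\<lambda>x. \<Sum>i<n. g N ((T ^^ i) x))" for n
    by (intro Bochner_Integration.integrable_sum integrable_const_bound[where B=C])
      (auto intro!: AE_I2 C iterate_space)
  have *: "real N * (\<integral>x. g n x \<partial>M) \<le> real n * (\<integral>x. g N x \<partial>M) + K" for n
  proof -
    have "(\<integral>x. real N * g n x \<partial>M) \<le> (\<integral>x. (\<Sum>i<n. g N ((T ^^ i) x)) + K \<partial>M)"
      by (intro integral_mono) (auto intro: g_integrable int K)
    also have "\<dots> = real n * (\<integral>x. g N x \<partial>M) + K"
      using int integral_orbit_sum[of "g N" C n] C by (simp add: prob_space)
    finally show ?thesis by simp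
  qed
  have "(\<lambda>n. (K / N) / real n) \<longlonglongrightarrow> 0"
    by (rule lim_const_over_n)
  then have "\<forall>\<^sub>F n in sequentially. (K / N) / real n < \<delta>"
    using assms by (auto dest: order_tendstoD)
  then show ?thesis
    using eventually_gt_at_top[of 0]
  proof eventually_elim
    case (elim n)
    have "(\<integral>x. g n x \<partial>M) / n \<le> (\<integral>x. g N x \<partial>M) / N + (K / N) / real n"
      using *[of n] elim assms by (simp add: field_simps)
    with elim show ?case by linarith
  qed
qed

text \<open>A single negative mean would, by \<open>mean_le_average\<close>, keep all later
  normalised means below a negative constant; \<open>\<delta>\<close> is half its distance to
  zero.\<close>

lemma mean_nonneg_of_lim_zero:
  assumes lim: "(\<lambda>n. (\<integral>x. g n x \<partial>M) / n) \<longlonglongrightarrow> 0"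
  shows "0 \<le> (\<integral>x. g N x \<partial>M)"
proof (rule ccontr)
  assume neg: "\<not> ?thesis"
  then have "1 \<le> N"
    using integral_g_zero by (cases N) auto
  define \<delta> where "\<delta> = - (\<integral>x. g N x \<partial>M) / N / 2"
  have "0 < \<delta>" using neg \<open>1 \<le> N\<close> by (simp add: \<delta>_def field_simps)
  have eq: "(\<integral>x. g N x \<partial>M) / N + \<delta> = - \<delta>" by (simp add: \<delta>_def)
  have "\<forall>\<^sub>F n in sequentially. (\<integral>x. g n x \<partial>M) / n < - \<delta>"
    using mean_le_average[OF \<open>1 \<le> N\<close> \<open>0 < \<delta>\<close>] unfolding eq .
  moreover have "\<forall>\<^sub>F n in sequentially. - \<delta> < (\<integral>x. g n x \<partial>M) / n"
    using \<open>0 < \<delta>\<close> by (intro order_tendstoD(1)[OF lim]) simp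
  ultimately have "\<forall>\<^sub>F n in sequentially. False" by eventually_elim simp
  then show False by simp
qed

text \<open>
  Starting at \<open>0\<close>, repeatedly jump ahead by an \<open>m \<le> N\<close> with \<open>g m \<le> - \<epsilon> m\<close> if there is one, and
  by one step otherwise.
\<close>

lemma g_le_stopping:
  fixes \<epsilon> :: real and N :: nat
  defines "B \<equiv> {x \<in> space M. \<forall>m\<in>{1..N}. - \<epsilon> * real m < g m x}"
  assumes "0 < \<epsilon>" and C: "0 \<le> C" "\<And>x. x \<in> space M \<Longrightarrow> g 1 x \<le> C" and "x \<in> space M"
  shows "g n x \<le> - \<epsilon> * n + (C + \<epsilon>) * (\<Sum>i<n. indicator B ((T ^^ i) x)) + N * (C + \<epsilon>)"
  using \<open>x \<in> space M\<close>
proof (induction n arbitrary: x rule: less_induct)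
  case (less n)
  have pos: "0 \<le> C + \<epsilon>" using assms by simp
  \<comment> \<open>A remainder of length at most \<open>N\<close> may be too short for a jump and
    is charged to \<open>N * (C + \<epsilon>)\<close>. A unit step from a point of \<open>B\<close>
    costs at most \<open>C\<close>, that is \<open>- \<epsilon>\<close> plus the charge
    \<open>C + \<epsilon>\<close> for the visit. Outside \<open>B\<close> a jump brings the full
    gain.\<close>
  consider "n \<le> N" | "N < n" "x \<in> B" | "N < n" "x \<notin> B" by linarith
  then show ?case
  proof cases
    case 1
    have "g n x \<le> real n * C" by (rule g_le_linear) (use C less in auto)
    also have "\<dots> = - \<epsilon> * n + real n * (C + \<epsilon>)" by (simp add: algebra_simps)
    also have "real n * (C + \<epsilon>) \<le> real N * (C + \<epsilon>)"
      using 1 pos by (intro mult_right_mono) auto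
    also have "- \<epsilon> * n + real N * (C + \<epsilon>) \<le> - \<epsilon> * n + (C + \<epsilon>) * (\<Sum>i<n. indicator B ((T ^^ i) x)) + N * (C + \<epsilon>)"
      using pos by (simp add: sum_nonneg)
    finally show ?thesis by simp
  next
    case 2
    then obtain k where n: "n = Suc k" by (cases n) auto
    have "g (1 + k) x \<le> g 1 x + g k ((T ^^ 1) x)" by (rule g_subadd) fact
    also have "g k ((T ^^ 1) x) \<le> - \<epsilon> * k + (C + \<epsilon>) * (\<Sum>i<k. indicator B ((T ^^ i) ((T ^^ 1) x))) + N * (C + \<epsilon>)"
      by (rule less.IH[OF _ iterate_space[OF less.prems]]) (simp add: n)
    also have "g 1 x \<le> C" using C less by blast
    also have "(\<Sum>i<k. indicator B ((T ^^ i) ((T ^^ 1) x))) = (\<Sum>i<n. indicator B ((T ^^ i) x)) - (1 :: real)"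
      unfolding n sum.lessThan_Suc_shift using 2 by (simp add: funpow_swap1)
    finally show ?thesis
      by (simp add: n algebra_simps)
  next
    case 3
    then obtain m where m: "1 \<le> m" "m \<le> N" "g m x \<le> - \<epsilon> * m"
      using less by (auto simp: B_def not_less)
    define k where "k = n - m"
    have n: "n = m + k" and k: "k < n" using m 3 by (auto simp: k_def)
    have "g (m + k) x \<le> g m x + g k ((T ^^ m) x)" by (rule g_subadd) fact
    also have "g k ((T ^^ m) x) \<le> - \<epsilon> * k + (C + \<epsilon>) * (\<Sum>i<k. indicator B ((T ^^ i) ((T ^^ m) x))) + N * (C + \<epsilon>)"
      by (rule less.IH[OF k iterate_space[OF less.prems]])
    also have "(\<Sum>i<k. indicator B ((T ^^ i) ((T ^^ m) x))) = (\<Sum>i\<in>{m..<n}. indicator B ((T ^^ i) x) :: real)"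
      unfolding n by (simp add: sum.atLeastLessThan_shift_0[of _ m] lessThan_atLeast0 add.commute[of m] funpow_add)
    \<comment> \<open>Visits to \<open>B\<close> during the jump have not been counted; adding them
      can only raise the bound.\<close>
    also have "(C + \<epsilon>) * (\<Sum>i\<in>{m..<n}. indicator B ((T ^^ i) x)) \<le> (C + \<epsilon>) * (\<Sum>i<n. indicator B ((T ^^ i) x))"
      using pos by (intro mult_left_mono sum_mono2) auto
    also have "g m x \<le> - \<epsilon> * m" by fact
    finally show ?thesis
      by (simp add: n algebra_simps)
  qed
qed

end

lemma (in measure_preserving_map) additive_process:
  fixes \<phi> :: "'a \<Rightarrow> real"
  assumes [measurable]: "\<phi> \<in> borel_measurable M" and bd: "\<And>x. x \<in> space M \<Longrightarrow> \<bar>\<phi> x\<bar> \<le> C"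
  shows "subadditive_process M T (\<lambda>n x. \<Sum>i<n. \<phi> ((T ^^ i) x))"
proof (unfold_locales, goal_cases)
  case (1 n)
  then show ?case by measurable
next
  case (2 n)
  have "\<bar>\<Sum>i<n. \<phi> ((T ^^ i) x)\<bar> \<le> (\<Sum>i<n. C)" if "x \<in> space M" for x
    using that by (intro sum_abs[THEN order_trans] sum_mono bd iterate_space)
  then show ?case by blast
next
  case (3 x)
  then show ?case by simp
next
  case (4 x n m)
  show ?case by (simp add: orbit_sum_add)
qed

section \<open>Ergodic maps: Birkhoff's and Kingman's theorems\<close>

locale ergodic_map = measure_preserving_map +
  assumes ergodic: "A \<in> sets M \<Longrightarrow> T -` A \<inter> space M = A \<Longrightarrow> emeasure M A = 0 \<or> emeasure M A = 1"
begin

text \<open>The iterated preimages \<open>F n\<close> decrease and all have the measure of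
  \<open>E\<close>. Their intersection is strictly invariant and has the same measure, so ergodicity
  applies to it.\<close>

lemma almost_invariant_null_or_full:
  assumes [measurable]: "E \<in> sets M" and pre: "\<And>x. x \<in> space M \<Longrightarrow> T x \<in> E \<Longrightarrow> x \<in> E"
  shows "emeasure M E = 0 \<or> emeasure M E = 1"
proof -
  define F where "F n = (T ^^ n) -` E \<inter> space M" for n
  have F [measurable]: "F n \<in> sets M" for n
    unfolding F_def by measurable
  have step: "F (Suc n) \<subseteq> F n" for n
    unfolding F_def using iterate_space pre by fastforce
  then have "decseq F"
    by (rule decseq_SucI)
  have "T -` (\<Inter>n. F n) \<inter> space M = (\<Inter>n. F (Suc n))"
    by (auto simp: F_def funpow_Suc_right measurable_space[OF T_measurable] simp del: funpow.simps)
  also have "\<dots> = (\<Inter>n. F n)"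
    using step by blast
  finally have "emeasure M (\<Inter>n. F n) = 0 \<or> emeasure M (\<Inter>n. F n) = 1"
    by (intro ergodic) auto
  moreover have "(INF n. emeasure M (F n)) = emeasure M (\<Inter>n. F n)"
    using \<open>decseq F\<close> by (intro INF_emeasure_decseq) auto
  moreover have "emeasure M (F n) = emeasure M E" for n
    unfolding F_def by (rule emeasure_iterate_vimage) measurable
  ultimately show ?thesis by simp
qed

end

locale ergodic_subadditive_process = ergodic_map + subadditive_process
begin

text \<open>Passing from \<open>T x\<close> back to \<open>x\<close> costs the bounded amount
  \<open>g 1 x\<close> and shifts \<open>n\<close> by one. Enlarging the index \<open>k\<close> of
  the margin \<open>1 / Suc k\<close> by one gains an amount linear in \<open>n\<close>, which
  eventually exceeds this cost; hence the union over \<open>k\<close>.\<close>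

lemma frequently_le_null_or_full:
  "emeasure M {x \<in> space M. \<exists>k. \<forall>m. \<exists>n\<ge>m. g n x \<le> - (c + 1 / Suc k) * real n} \<in> {0, 1}"
    (is "emeasure M ?E \<in> _")
proof -
  have [measurable]: "?E \<in> sets M" by measurable
  obtain C where C: "\<And>x. x \<in> space M \<Longrightarrow> \<bar>g 1 x\<bar> \<le> C"
    using g_bounded by blast
  have "x \<in> ?E" if x: "x \<in> space M" and Tx: "T x \<in> ?E" for x
  proof -
    obtain k where k: "\<And>m. \<exists>n\<ge>m. g n (T x) \<le> - (c + 1 / Suc k) * real n"
      using Tx by blast
    define d where "d = 1 / Suc k - 1 / Suc (Suc k)"
    have d: "0 < d" by (simp add: d_def frac_less2 del: of_nat_Suc)
    \<comment> \<open>The total constant loss: \<open>C\<close> for the first step and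
      \<open>c + 1 / Suc (Suc k)\<close> for the shift of \<open>n\<close>. It is absorbed once
      \<open>n\<close> is at least \<open>b / d\<close>.\<close>
    define b where "b = C + c + 1 / Suc (Suc k)"
    have "\<exists>n\<ge>m. g n x \<le> - (c + 1 / Suc (Suc k)) * real n" for m
    proof -
      obtain l :: nat where l: "b / d \<le> real l" using real_arch_simple by blast
      obtain n where n: "n \<ge> max m l" "g n (T x) \<le> - (c + 1 / Suc k) * real n"
        using k by blast
      have "b / d \<le> real n" using l n by linarith
      then have "b \<le> d * real n" using d by (simp add: field_simps)
      have "g (1 + n) x \<le> g 1 x + g n ((T ^^ 1) x)" by (rule g_subadd) fact
      also have "\<dots> \<le> C + - (c + 1 / Suc k) * real n"
        using n C[OF x] by (intro add_mono) auto
      also have "\<dots> = - (c + 1 / Suc (Suc k)) * real (Suc n) + (b - d * real n)"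
        by (simp add: b_def d_def algebra_simps add_divide_distrib)
      also have "\<dots> \<le> - (c + 1 / Suc (Suc k)) * real (Suc n)"
        using \<open>b \<le> d * real n\<close> by simp
      finally show ?thesis using n by (intro exI[of _ "Suc n"]) simp
    qed
    then show ?thesis using x by blast
  qed
  then show ?thesis using almost_invariant_null_or_full[of ?E] by auto
qed

text \<open>The stopping time argument of Katznelson and Weiss for Kingman's theorem.\<close>

lemma AE_eventually_gt:
  assumes nonneg: "\<And>n. 0 \<le> (\<integral>x. g n x \<partial>M)" and "0 < c"
  shows "AE x in M. \<forall>\<^sub>F n in sequentially. - c * real n < g n x"
proof -
  \<comment> \<open>Halving \<open>c\<close> leaves room for the margin:
    \<open>\<epsilon> + 1 / Suc k\<close> stays below \<open>c\<close> for large
    \<open>k\<close>.\<close>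
  define \<epsilon> where "\<epsilon> = c / 2"
  have \<epsilon>: "0 < \<epsilon>" using assms by (simp add: \<epsilon>_def)
  define E where "E = {x \<in> space M. \<exists>k. \<forall>m. \<exists>n\<ge>m. g n x \<le> - (\<epsilon> + 1 / Suc k) * real n}"
  have [measurable]: "E \<in> sets M" unfolding E_def by measurable
  obtain C where C: "0 \<le> C" "\<And>n x. n < 2 \<Longrightarrow> x \<in> space M \<Longrightarrow> \<bar>g n x\<bar> \<le> C"
    using common_bound[of 2] by metis
  have C1: "g 1 x \<le> C" if "x \<in> space M" for x
    using C(2)[of 1 x] that by auto
  define B where "B N = {x \<in> space M. \<forall>m\<in>{1..N}. - \<epsilon> * real m < g m x}" for N
  have B [measurable]: "B N \<in> sets M" for N unfolding B_def by measurable
  \<comment> \<open>Integrating \<open>g_le_stopping\<close> against nonnegative means and letting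
    \<open>n\<close> grow shows that the points without a jump of length at most \<open>N\<close>
    keep a probability bounded away from zero, uniformly in \<open>N\<close>.\<close>
  have bound: "\<epsilon> \<le> (C + \<epsilon>) * prob (B N)" for N
  proof -
    have *: "real n * (\<epsilon> - (C + \<epsilon>) * prob (B N)) \<le> N * (C + \<epsilon>)" for n
    proof -
      have int: "integrable M (\<lambda>x. \<Sum>i<n. indicator (B N) ((T ^^ i) x) :: real)"
        by (intro Bochner_Integration.integrable_sum integrable_const_bound[where B=1]) auto
      have "0 \<le> (\<integral>x. g n x \<partial>M)" by fact
      also have "\<dots> \<le> (\<integral>x. - \<epsilon> * n + (C + \<epsilon>) * (\<Sum>i<n. indicator (B N) ((T ^^ i) x)) + N * (C + \<epsilon>) \<partial>M)"
      proof (rule integral_mono[OF g_integrable])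
        show "integrable M (\<lambda>x. - \<epsilon> * n + (C + \<epsilon>) * (\<Sum>i<n. indicator (B N) ((T ^^ i) x)) + N * (C + \<epsilon>))"
          using int by simp
        show "g n x \<le> - \<epsilon> * n + (C + \<epsilon>) * (\<Sum>i<n. indicator (B N) ((T ^^ i) x)) + N * (C + \<epsilon>)"
          if "x \<in> space M" for x
          unfolding B_def by (rule g_le_stopping[OF \<epsilon> C(1) C1 that])
      qed
      also have "\<dots> = - \<epsilon> * n + (C + \<epsilon>) * (real n * prob (B N)) + N * (C + \<epsilon>)"
        using int integral_orbit_sum[of "indicator (B N)" 1 n] by (simp add: prob_space)
      finally show ?thesis by (simp add: algebra_simps)
    qed
    show ?thesis
    proof (rule ccontr)
      assume "\<not> ?thesis"
      then have "0 < \<epsilon> - (C + \<epsilon>) * prob (B N)" by simp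
      then obtain n :: nat where "N * (C + \<epsilon>) < real n * (\<epsilon> - (C + \<epsilon>) * prob (B N))"
        using reals_Archimedean3 by blast
      with *[of n] show False by simp
    qed
  qed
  have "decseq B" by (auto simp: B_def decseq_def)
  then have lim: "(\<lambda>N. prob (B N)) \<longlonglongrightarrow> prob (\<Inter>N. B N)"
    by (intro finite_Lim_measure_decseq) auto
  \<comment> \<open>If \<open>E\<close> had full measure, almost every point would have a jump of
    some length, so the sets \<open>B N\<close> would decrease to a null set, against
    \<open>bound\<close>.\<close>
  have "emeasure M E \<noteq> 1"
  proof
    assume "emeasure M E = 1"
    then have "AE x in M. x \<in> E" by (simp add: AE_in_set_eq_1 emeasure_eq_measure)
    then have "AE x in M. x \<notin> (\<Inter>N. B N)"
    proof eventually_elim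
      case (elim x)
      then obtain k where "\<And>m. \<exists>n\<ge>m. g n x \<le> - (\<epsilon> + 1 / Suc k) * real n"
        by (auto simp: E_def)
      then obtain n where n: "1 \<le> n" "g n x \<le> - (\<epsilon> + 1 / Suc k) * real n" by blast
      have "- (\<epsilon> + 1 / Suc k) * real n \<le> - \<epsilon> * real n"
        by (intro mult_right_mono) auto
      with n have "x \<notin> B n" by (force simp: B_def)
      then show ?case by blast
    qed
    then have "prob (\<Inter>N. B N) = 0"
      by (subst prob_eq_0) auto
    then have "(\<lambda>N. (C + \<epsilon>) * prob (B N)) \<longlonglongrightarrow> (C + \<epsilon>) * 0"
      using lim by (intro tendsto_intros) simp
    then have "\<epsilon> \<le> (C + \<epsilon>) * 0"
      using bound by (intro LIMSEQ_le_const) auto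
    with \<epsilon> show False by simp
  qed
  with frequently_le_null_or_full[of \<epsilon>] have "emeasure M E = 0"
    by (simp add: E_def)
  then have "AE x in M. x \<notin> E"
    by (intro AE_not_in) (auto simp: null_sets_def)
  then show ?thesis
  proof (rule AE_mp, intro AE_I2 impI)
    fix x assume x: "x \<in> space M" "x \<notin> E"
    obtain k where k: "1 / Suc k < \<epsilon>"
      using \<epsilon> nat_approx_posE by metis
    have "\<forall>k. \<exists>m. \<forall>n\<ge>m. \<not> g n x \<le> - (\<epsilon> + 1 / Suc k) * real n"
      using x unfolding E_def by blast
    then obtain m where "\<And>n. m \<le> n \<Longrightarrow> - (\<epsilon> + 1 / Suc k) * real n < g n x"
      by (meson not_le)
    moreover have "- c * real n \<le> - (\<epsilon> + 1 / Suc k) * real n" for n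
      using k by (intro mult_right_mono) (auto simp: \<epsilon>_def)
    ultimately show "\<forall>\<^sub>F n in sequentially. - c * real n < g n x"
      unfolding eventually_sequentially by (meson le_less_trans)
  qed
qed

end

text \<open>The additive process generated by \<open>a - \<phi>\<close> has mean zero at every
  index, so the lower bound \<open>AE_eventually_gt\<close> applies to it.\<close>

lemma (in ergodic_map) AE_birkhoff_upper:
  fixes \<phi> :: "'a \<Rightarrow> real"
  assumes [measurable]: "\<phi> \<in> borel_measurable M" and bd: "\<And>x. x \<in> space M \<Longrightarrow> \<bar>\<phi> x\<bar> \<le> C" and "0 < \<delta>"
  shows "AE x in M. \<forall>\<^sub>F n in sequentially. (\<Sum>i<n. \<phi> ((T ^^ i) x)) < real n * ((\<integral>x. \<phi> x \<partial>M) + \<delta>)"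
proof -
  define a where "a = (\<integral>x. \<phi> x \<partial>M)"
  define \<psi> where "\<psi> x = a - \<phi> x" for x
  have [measurable]: "\<psi> \<in> borel_measurable M" unfolding \<psi>_def by measurable
  have int: "integrable M \<phi>"
    by (intro integrable_const_bound[where B=C]) (auto intro!: AE_I2 bd)
  have bd': "\<bar>\<psi> x\<bar> \<le> \<bar>a\<bar> + C" if "x \<in> space M" for x
    using bd[OF that] by (auto simp: \<psi>_def)
  interpret P: subadditive_process M T "\<lambda>n x. \<Sum>i<n. \<psi> ((T ^^ i) x)"
    by (rule additive_process[where C="\<bar>a\<bar> + C"]) (use bd' in auto)
  interpret P: ergodic_subadditive_process M T "\<lambda>n x. \<Sum>i<n. \<psi> ((T ^^ i) x)" ..
  have "(\<integral>x. \<psi> x \<partial>M) = 0"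
    using int by (simp add: \<psi>_def a_def prob_space)
  then have "(\<integral>x. (\<Sum>i<n. \<psi> ((T ^^ i) x)) \<partial>M) = 0" for n
    using integral_orbit_sum[of \<psi>, OF _ bd'] by simp
  then have "AE x in M. \<forall>\<^sub>F n in sequentially. - \<delta> * real n < (\<Sum>i<n. \<psi> ((T ^^ i) x))"
    using \<open>0 < \<delta>\<close> by (intro P.AE_eventually_gt) auto
  then show ?thesis
    by eventually_elim (auto simp: \<psi>_def sum_subtractf a_def[symmetric] algebra_simps elim!: eventually_mono)
qed

context ergodic_subadditive_process
begin

text \<open>Block averaging reduces the claim to Birkhoff's theorem for \<open>g N\<close>. Half of
  \<open>\<delta>\<close> is spent there, and the other half absorbs the constant \<open>K\<close>
  for large \<open>n\<close>.\<close>

lemma AE_eventually_lt: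
  assumes "1 \<le> N" and "0 < \<delta>"
  shows "AE x in M. \<forall>\<^sub>F n in sequentially. g n x < real n * ((\<integral>x. g N x \<partial>M) / N + \<delta>)"
proof -
  obtain K where K: "\<And>n x. x \<in> space M \<Longrightarrow> real N * g n x \<le> (\<Sum>i<n. g N ((T ^^ i) x)) + K"
    using g_le_average[of N] by metis
  obtain C where C: "\<And>x. x \<in> space M \<Longrightarrow> \<bar>g N x\<bar> \<le> C"
    using g_bounded by blast
  have "AE x in M. \<forall>\<^sub>F n in sequentially.
      (\<Sum>i<n. g N ((T ^^ i) x)) < real n * ((\<integral>x. g N x \<partial>M) + \<delta> / 2)"
    using C assms by (intro AE_birkhoff_upper) auto
  then show ?thesis
  proof (rule AE_mp, intro AE_I2 impI)
    fix x assume x: "x \<in> space M"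
      "\<forall>\<^sub>F n in sequentially. (\<Sum>i<n. g N ((T ^^ i) x)) < real n * ((\<integral>x. g N x \<partial>M) + \<delta> / 2)"
    obtain k :: nat where k: "K / (\<delta> / 2) \<le> real k" using real_arch_simple by blast
    from x(2) eventually_ge_at_top[of k]
    show "\<forall>\<^sub>F n in sequentially. g n x < real n * ((\<integral>x. g N x \<partial>M) / N + \<delta>)"
    proof eventually_elim
      case (elim n)
      have "K / (\<delta> / 2) \<le> real n" using k elim by linarith
      then have "K \<le> real n * (\<delta> / 2)" using assms by (simp add: field_simps)
      with elim K[OF x(1), of n] have "real N * g n x < real n * ((\<integral>x. g N x \<partial>M) + \<delta>)"
        by (simp add: algebra_simps)
      also have "\<dots> \<le> real n * ((\<integral>x. g N x \<partial>M) + real N * \<delta>)"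
        using assms by (intro mult_left_mono) auto
      also have "\<dots> = real N * (real n * ((\<integral>x. g N x \<partial>M) / N + \<delta>))"
        using assms by (simp add: field_simps)
      finally show ?case using assms by simp
    qed
  qed
qed

text \<open>If the means vanish in the limit, they are all nonnegative, which gives the lower bound
  almost everywhere, while a single \<open>N\<close> with small mean gives the upper one.
  Conversely, pointwise convergence excludes negative means, and the means are then squeezed below
  the integrals of the positive parts.\<close>

lemma AE_lim_zero_iff_mean_lim_zero:
  "(AE x in M. (\<lambda>n. g n x / n) \<longlonglongrightarrow> 0) \<longleftrightarrow> (\<lambda>n. (\<integral>x. g n x \<partial>M) / n) \<longlonglongrightarrow> 0"
proof
  assume lim: "(\<lambda>n. (\<integral>x. g n x \<partial>M) / n) \<longlonglongrightarrow> 0"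
  have nonneg: "0 \<le> (\<integral>x. g N x \<partial>M)" for N
    using lim by (rule mean_nonneg_of_lim_zero)
  have lower: "AE x in M. \<forall>k. \<forall>\<^sub>F n in sequentially. - (1 / Suc k) * real n < g n x"
    unfolding AE_all_countable using nonneg by (intro allI AE_eventually_gt) auto
  have "AE x in M. \<forall>\<^sub>F n in sequentially. g n x < real n * (1 / Suc k)" for k
  proof -
    have "\<forall>\<^sub>F N in sequentially. (\<integral>x. g N x \<partial>M) / N < 1 / Suc k / 2"
      using lim by (rule order_tendstoD) simp
    then have "\<forall>\<^sub>F N in sequentially. 1 \<le> N \<and> (\<integral>x. g N x \<partial>M) / N < 1 / Suc k / 2"
      using eventually_ge_at_top[of 1] by eventually_elim auto
    then obtain N where N: "1 \<le> N" "(\<integral>x. g N x \<partial>M) / N < 1 / Suc k / 2"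
      by (auto dest: eventually_happens)
    have "AE x in M. \<forall>\<^sub>F n in sequentially. g n x < real n * ((\<integral>x. g N x \<partial>M) / N + 1 / Suc k / 2)"
      using N by (intro AE_eventually_lt) auto
    then show ?thesis
    proof eventually_elim
      case (elim x)
      then show ?case
      proof eventually_elim
        case (elim n)
        have "real n * ((\<integral>x. g N x \<partial>M) / N + 1 / Suc k / 2) \<le> real n * (1 / Suc k)"
        proof (rule mult_left_mono)
          show "(\<integral>x. g N x \<partial>M) / N + 1 / Suc k / 2 \<le> 1 / Suc k"
            using N(2) by linarith
        qed simp
        with elim show ?case by linarith
      qed
    qed
  qed
  then have "AE x in M. \<forall>k. \<forall>\<^sub>F n in sequentially. g n x < real n * (1 / Suc k)"
    unfolding AE_all_countable by blast
  with lower show "AE x in M. (\<lambda>n. g n x / n) \<longlonglongrightarrow> 0"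
  proof eventually_elim
    case (elim x)
    show ?case
    proof (rule tendstoI)
      fix e :: real assume "0 < e"
      then obtain k where k: "1 / Suc k < e" using nat_approx_posE by metis
      from elim(1)[rule_format, of k] elim(2)[rule_format, of k] eventually_gt_at_top[of 0]
      show "\<forall>\<^sub>F n in sequentially. dist (g n x / n) 0 < e"
      proof eventually_elim
        case (elim n)
        then have "\<bar>g n x / n\<bar> < 1 / Suc k" by (auto simp: field_simps abs_less_iff)
        with k show ?case by (simp add: dist_real_def)
      qed
    qed
  qed
next
  assume lim: "AE x in M. (\<lambda>n. g n x / n) \<longlonglongrightarrow> 0"
  have nonneg: "0 \<le> (\<integral>x. g N x \<partial>M)" for N
  proof (rule ccontr)
    assume neg: "\<not> ?thesis"
    then have "1 \<le> N"
      using integral_g_zero by (cases N) auto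
    define \<delta> where "\<delta> = - (\<integral>x. g N x \<partial>M) / N / 2"
    have "0 < \<delta>" using neg \<open>1 \<le> N\<close> by (simp add: \<delta>_def field_simps)
    have eq: "(\<integral>x. g N x \<partial>M) / N + \<delta> = - \<delta>" by (simp add: \<delta>_def)
    have "AE x in M. \<forall>\<^sub>F n in sequentially. g n x < real n * - \<delta>"
      using AE_eventually_lt[OF \<open>1 \<le> N\<close> \<open>0 < \<delta>\<close>] unfolding eq .
    with lim have "AE x in M. False"
    proof eventually_elim
      case (elim x)
      have "\<forall>\<^sub>F n in sequentially. - \<delta> < g n x / n"
        using \<open>0 < \<delta>\<close> by (intro order_tendstoD(1)[OF elim(1)]) simp
      with elim(2) have "\<forall>\<^sub>F n in sequentially. False"
        using eventually_gt_at_top[of 0] by eventually_elim (auto simp: field_simps)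
      then show ?case by simp
    qed
    then show False by simp
  qed
  obtain C where C: "0 \<le> C" "\<And>n x. n < 2 \<Longrightarrow> x \<in> space M \<Longrightarrow> \<bar>g n x\<bar> \<le> C"
    using common_bound[of 2] by metis
  have le: "g n x / n \<le> C" if "x \<in> space M" for n x
  proof -
    have "g n x \<le> real n * C"
      using that C(2)[of 1] by (intro g_le_linear) (auto intro: abs_le_D1)
    then show ?thesis using C(1) by (cases "n = 0") (auto simp: field_simps)
  qed
  \<comment> \<open>Subadditivity bounds \<open>g n x / n\<close> uniformly in \<open>n\<close> only
    from above, so dominated convergence is applied to the positive part.\<close>
  have int: "integrable M (\<lambda>x. max (g n x / n) 0)" for n
    by (rule integrable_const_bound[where B=C]) (use le C in \<open>auto intro!: AE_I2\<close>)
  have "(\<lambda>n. \<integral>x. max (g n x / n) 0 \<partial>M) \<longlonglongrightarrow> (\<integral>x. 0 \<partial>M)"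
  proof (rule integral_dominated_convergence[where w="\<lambda>x. C"])
    show "AE x in M. (\<lambda>n. max (g n x / n) 0) \<longlonglongrightarrow> 0"
      using lim
    proof eventually_elim
      case (elim x)
      then have "(\<lambda>n. max (g n x / n) 0) \<longlonglongrightarrow> max 0 0" by (intro tendsto_max) auto
      then show ?case by simp
    qed
  qed (use le C in \<open>auto intro!: AE_I2\<close>)
  then have upper: "(\<lambda>n. \<integral>x. max (g n x / n) 0 \<partial>M) \<longlonglongrightarrow> 0" by simp
  show "(\<lambda>n. (\<integral>x. g n x \<partial>M) / n) \<longlonglongrightarrow> 0"
  proof (rule tendsto_sandwich[OF _ _ tendsto_const upper])
    show "\<forall>\<^sub>F n in sequentially. 0 \<le> (\<integral>x. g n x \<partial>M) / n"
      using nonneg by (intro always_eventually) auto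
    have "(\<integral>x. g n x / n \<partial>M) \<le> (\<integral>x. max (g n x / n) 0 \<partial>M)" for n
      by (intro integral_mono int) (auto intro: g_integrable)
    then show "\<forall>\<^sub>F n in sequentially. (\<integral>x. g n x \<partial>M) / n \<le> (\<integral>x. max (g n x / n) 0 \<partial>M)"
      by (intro always_eventually) simp
  qed
qed

end

section \<open>Invariant measures of a subshift\<close>

locale subshift_system =
  fixes X :: "(nat \<Rightarrow> nat) set"
  assumes subshift: "subshift X"
begin

lemma alphabet:
  obtains k where "1 \<le> k" and "\<forall>x\<in>X. \<forall>i. x i \<in> {1..k}"
  using subshift unfolding subshift_def by blast

lemma closed_X: "closed X"
  using subshift unfolding subshift_def by blast

lemma shift_map_X: "x \<in> X \<Longrightarrow> shift_map x \<in> X"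
  using subshift unfolding subshift_def by blast

lemma iterate_shift_map_X: "x \<in> X \<Longrightarrow> (shift_map ^^ n) x \<in> X"
  by (induction n) (auto intro: shift_map_X)

text \<open>Tychonoff's theorem for a finite alphabet; \<open>X\<close> is a closed subset of the
  product.\<close>

lemma compact_X: "compact X"
proof -
  obtain k where k: "\<And>x i. x \<in> X \<Longrightarrow> x i \<in> {1..k}"
    using alphabet by metis
  have "compactin (product_topology (\<lambda>i. euclidean) UNIV) (Pi\<^sub>E UNIV (\<lambda>i :: nat. {1..k}))"
    unfolding compactin_PiE by (auto intro: finite_imp_compact)
  then have "compact (Pi\<^sub>E UNIV (\<lambda>i :: nat. {1..k}))"
    by (simp add: euclidean_product_topology)
  then have "compact (Pi\<^sub>E UNIV (\<lambda>i :: nat. {1..k}) \<inter> X)"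
    using closed_X by (rule compact_Int_closed)
  moreover have "Pi\<^sub>E UNIV (\<lambda>i :: nat. {1..k}) \<inter> X = X"
    using k by auto
  ultimately show ?thesis by simp
qed

lemma continuous_on_coordinate: "continuous_on S (\<lambda>x :: nat \<Rightarrow> nat. x i)"
  by (rule continuous_on_subset[OF continuous_on_product_coordinates]) simp

lemma continuous_on_shift_map: "continuous_on S (shift_map :: (nat \<Rightarrow> nat) \<Rightarrow> _)"
  unfolding shift_map_def
  by (intro continuous_on_coordinatewise_then_product continuous_on_coordinate)

lemma continuous_on_iterate_shift_map: "continuous_on X (shift_map ^^ n)"
proof (induction n)
  case (Suc n)
  then show ?case
    using continuous_on_compose[OF Suc continuous_on_shift_map] by (simp only: funpow.simps)
qed (simp add: continuous_on_id id_def)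

lemma continuous_on_iterate_compose:
  assumes "continuous_on X \<phi>"
  shows "continuous_on X (\<lambda>x. \<phi> ((shift_map ^^ n) x))"
  using assms continuous_on_iterate_shift_map
  by (rule continuous_on_compose2) (auto intro: iterate_shift_map_X)

lemma continuous_bounded:
  assumes "continuous_on X \<phi>"
  obtains C :: real where "0 \<le> C" and "\<forall>x\<in>X. \<bar>\<phi> x\<bar> \<le> C"
proof -
  have "bounded (\<phi> ` X)"
    using assms compact_X by (intro compact_imp_bounded compact_continuous_image)
  then obtain C where C: "\<And>x. x \<in> X \<Longrightarrow> \<bar>\<phi> x\<bar> \<le> C"
    unfolding bounded_iff by auto
  show ?thesis
    by (rule that[of "max C 0"]) (use C in \<open>auto intro: order_trans[OF _ max.cobounded1]\<close>)
qed

lemma invariant_measureD: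
  assumes "\<mu> \<in> invariant_measures X"
  shows "prob_space \<mu>" "sets \<mu> = sets (restrict_space borel X)" "space \<mu> = X"
    and "A \<in> sets \<mu> \<Longrightarrow> emeasure \<mu> (shift_map -` A \<inter> X) = emeasure \<mu> A"
proof -
  show "prob_space \<mu>" and sets: "sets \<mu> = sets (restrict_space borel X)"
    and "A \<in> sets \<mu> \<Longrightarrow> emeasure \<mu> (shift_map -` A \<inter> X) = emeasure \<mu> A"
    using assms by (auto simp: invariant_measures_def)
  show "space \<mu> = X"
    using sets_eq_imp_space_eq[OF sets] by (simp add: space_restrict_space)
qed

lemma shift_map_measurable:
  assumes "sets \<mu> = sets (restrict_space borel X)"
  shows "shift_map \<in> \<mu> \<rightarrow>\<^sub>M \<mu>"
proof -
  have "shift_map \<in> restrict_space borel X \<rightarrow>\<^sub>M restrict_space borel X"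
    by (intro measurable_restrict_space2 borel_measurable_continuous_on_restrict continuous_on_shift_map)
      (auto simp: space_restrict_space shift_map_X)
  then show ?thesis
    unfolding measurable_cong_sets[OF assms assms] .
qed

lemma measurable_continuous_on:
  fixes \<phi> :: "_ \<Rightarrow> real"
  assumes "sets \<mu> = sets (restrict_space borel X)" and "continuous_on X \<phi>"
  shows "\<phi> \<in> borel_measurable \<mu>"
  using borel_measurable_continuous_on_restrict[OF assms(2)]
  unfolding measurable_cong_sets[OF assms(1) refl] .

lemma integrable_continuous_on:
  fixes \<phi> :: "_ \<Rightarrow> real"
  assumes \<mu>: "\<mu> \<in> invariant_measures X" and \<phi>: "continuous_on X \<phi>"
  shows "integrable \<mu> \<phi>"
proof -
  interpret prob_space \<mu> using \<mu> by (rule invariant_measureD)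
  obtain C where "\<forall>x\<in>X. \<bar>\<phi> x\<bar> \<le> C" using continuous_bounded[OF \<phi>] by blast
  then show ?thesis
    using measurable_continuous_on[OF _ \<phi>] invariant_measureD[OF \<mu>]
    by (intro integrable_const_bound[where B=C]) (auto intro!: AE_I2)
qed

lemma measure_preserving_shift:
  assumes "\<mu> \<in> invariant_measures X"
  shows "measure_preserving_map \<mu> shift_map"
proof -
  interpret prob_space \<mu> using assms by (rule invariant_measureD)
  show ?thesis
    by unfold_locales (use invariant_measureD[OF assms] shift_map_measurable in auto)
qed

lemma ergodic_shift:
  assumes "\<mu> \<in> ergodic_measures X"
  shows "ergodic_map \<mu> shift_map"
proof -
  have \<mu>: "\<mu> \<in> invariant_measures X"
    using assms by (simp add: ergodic_measures_def)
  interpret measure_preserving_map \<mu> shift_map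
    using \<mu> by (rule measure_preserving_shift)
  show ?thesis
    by unfold_locales (use assms invariant_measureD[OF \<mu>] in \<open>auto simp: ergodic_measures_def\<close>)
qed

section \<open>Cylinder sets as a generator and as a family separating measures\<close>

definition cylinder :: "nat list \<Rightarrow> (nat \<Rightarrow> nat) set" where
  "cylinder w = {x \<in> X. \<forall>i<length w. x i = w ! i}"

lemma cylinder_Nil [simp]: "cylinder [] = X"
  by (simp add: cylinder_def)

lemma open_coordinates_eq: "open {x :: nat \<Rightarrow> nat. \<forall>i<n. x i = c i}"
proof -
  have "{x :: nat \<Rightarrow> nat. \<forall>i<n. x i = c i} = (\<Inter>i<n. (\<lambda>x. x i) -` {c i})"
    by auto
  then show ?thesis
    by (auto intro!: open_INT open_vimage discrete_topology_class.open_discrete)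
qed

lemma cylinder_sets: "cylinder w \<in> sets (restrict_space borel X)"
proof -
  have "cylinder w = X \<inter> {x. \<forall>i<length w. x i = w ! i}"
    by (auto simp: cylinder_def)
  then show ?thesis
    using open_coordinates_eq[of "length w" "\<lambda>i. w ! i"] by (auto simp: sets_restrict_space)
qed

text \<open>The indicator is a finite product of functions of one discrete coordinate each.
  Statements about integrals of continuous functions thereby pass to measures of cylinders.\<close>

lemma continuous_on_indicator_cylinder: "continuous_on X (indicator (cylinder w) :: _ \<Rightarrow> real)"
proof -
  have "continuous_on X (\<lambda>x :: nat \<Rightarrow> nat. \<Prod>i<length w. if x i = w ! i then 1 else 0 :: real)"
    by (intro continuous_on_prod continuous_on_compose2[OF Topological_Spaces.continuous_on_discrete continuous_on_coordinate])
      auto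
  moreover have "(\<Prod>i<length w. if x i = w ! i then 1 else 0 :: real) = indicator (cylinder w) x"
    if "x \<in> X" for x
    using that by (auto simp: cylinder_def indicator_def)
  ultimately show ?thesis
    by (subst continuous_on_cong[OF refl]) auto
qed

text \<open>A basic open set of the product topology restricts finitely many coordinates, and a long
  enough prefix of \<open>x\<close> fixes all of them.\<close>

lemma cylinder_neighbourhood:
  assumes "open U" and "x \<in> U" and "x \<in> X"
  obtains w where "x \<in> cylinder w" and "cylinder w \<subseteq> U"
proof -
  have "openin (product_topology (\<lambda>i. euclidean) UNIV) U"
    using assms by (simp add: open_fun_def)
  then obtain V where V: "finite {i. V i \<noteq> UNIV}" "x \<in> Pi\<^sub>E UNIV V" "Pi\<^sub>E UNIV V \<subseteq> U"
    using assms unfolding openin_product_topology_alt by force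
  obtain n where n: "{i. V i \<noteq> UNIV} \<subseteq> {..<n}"
    using V(1) finite_nat_iff_bounded by blast
  show ?thesis
  proof
    show "x \<in> cylinder (map x [0..<n])"
      using assms by (simp add: cylinder_def)
    have "y \<in> U" if y: "y \<in> cylinder (map x [0..<n])" for y
    proof -
      have "y i \<in> V i" for i
      proof (cases "V i = UNIV")
        case False
        then have "y i = x i"
          using n y by (auto simp: cylinder_def)
        then show ?thesis using V(2) by auto
      qed simp
      then show ?thesis using V(3) by auto
    qed
    then show "cylinder (map x [0..<n]) \<subseteq> U" by blast
  qed
qed

lemma sets_eq_sigma_cylinders:
  "sets (restrict_space borel X) = sigma_sets X (insert {} (range cylinder))" (is "_ = ?S")
proof
  interpret S: sigma_algebra X ?S
    by (rule sigma_algebra_sigma_sets) (auto simp: cylinder_def)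
  have *: "X \<inter> A \<in> ?S" if "A \<in> sigma_sets UNIV {S. open S}" for A
    using that
  proof (induction rule: sigma_sets.induct)
    case (Basic U)
    \<comment> \<open>An open set is a union of cylinders, and the union is countable because words
      are lists over a countable type.\<close>
    have "X \<inter> U = \<Union>(cylinder ` {w. cylinder w \<subseteq> U})"
    proof
      show "X \<inter> U \<subseteq> \<Union>(cylinder ` {w. cylinder w \<subseteq> U})"
      proof
        fix x assume "x \<in> X \<inter> U"
        with Basic obtain w where "x \<in> cylinder w" "cylinder w \<subseteq> U"
          using cylinder_neighbourhood[of U x] by auto
        then show "x \<in> \<Union>(cylinder ` {w. cylinder w \<subseteq> U})" by blast
      qed
    qed (auto simp: cylinder_def)
    also have "\<dots> \<in> ?S"
      by (intro S.countable_Union) auto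
    finally show ?case .
  next
    case (Compl A)
    have "X \<inter> (UNIV - A) = X - (X \<inter> A)" by auto
    then show ?case using Compl by auto
  next
    case (Union A)
    then have "(\<Union>i. X \<inter> A i) \<in> ?S" by (intro S.countable_UN) auto
    then show ?case by simp
  qed simp
  then show "sets (restrict_space borel X) \<subseteq> ?S"
    by (auto simp: sets_restrict_space borel_def)
  show "?S \<subseteq> sets (restrict_space borel X)"
  proof (rule sigma_algebra.sigma_sets_subset')
    show "sigma_algebra X (sets (restrict_space borel X))"
      using sets.sigma_algebra_axioms[of "restrict_space borel X"] by (simp add: space_restrict_space)
  qed (use cylinder_sets[of "[]"] in \<open>auto simp: cylinder_sets\<close>)
qed

text \<open>Two cylinders are either nested or disjoint, according to whether the shorter word is a
  prefix of the longer; the empty set is added for the second case.\<close>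

lemma Int_stable_cylinders: "Int_stable (insert {} (range cylinder))"
proof -
  have *: "cylinder v \<inter> cylinder w \<in> insert {} (range cylinder)" if "length v \<le> length w" for v w
  proof (cases "\<forall>i<length v. v ! i = w ! i")
    case True
    then have "cylinder v \<inter> cylinder w = cylinder w"
      using that by (auto simp: cylinder_def)
    then show ?thesis by simp
  next
    case False
    then have "cylinder v \<inter> cylinder w = {}"
      using that by (auto simp: cylinder_def)
    then show ?thesis by simp
  qed
  have "cylinder v \<inter> cylinder w \<in> insert {} (range cylinder)" for v w
    using *[of v w] *[of w v] by (cases "length v \<le> length w") (auto simp: Int_commute)
  then show ?thesis
    unfolding Int_stable_def by auto
qed

lemma measure_eqI_cylinder:
  assumes "finite_measure M" and M: "sets M = sets (restrict_space borel X)"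
    and "finite_measure N" and N: "sets N = sets (restrict_space borel X)"
    and eq: "\<And>w. measure M (cylinder w) = measure N (cylinder w)"
  shows "M = N"
proof (rule measure_eqI_generator_eq[OF Int_stable_cylinders, where \<Omega>=X and A="\<lambda>i. X"])
  show "sets M = sigma_sets X (insert {} (range cylinder))"
    and "sets N = sigma_sets X (insert {} (range cylinder))"
    using M N by (simp_all add: sets_eq_sigma_cylinders)
  show "emeasure M A = emeasure N A" if "A \<in> insert {} (range cylinder)" for A
    using that eq assms by (auto simp: finite_measure.emeasure_eq_measure)
  show "emeasure M X \<noteq> \<infinity>" for i :: nat
    using assms by (simp add: finite_measure.emeasure_eq_measure)
  show "range (\<lambda>i :: nat. X) \<subseteq> insert {} (range cylinder)"
    using cylinder_Nil by blast
qed (auto simp: cylinder_def)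

lemma integral_indicator_cylinder:
  assumes "sets \<mu> = sets (restrict_space borel X)"
  shows "(\<integral>x. indicator (cylinder w) x \<partial>\<mu>) = measure \<mu> (cylinder w)"
proof -
  have "cylinder w \<inter> space \<mu> = cylinder w"
    using sets_eq_imp_space_eq[OF assms] by (auto simp: cylinder_def space_restrict_space)
  then show ?thesis by simp
qed

text \<open>Cylinder indicators are continuous and determine a measure, so continuous functions
  suffice to test invariance. In this form invariance passes to weak limits.\<close>

lemma invariant_measuresI:
  assumes "prob_space \<nu>" and sets: "sets \<nu> = sets (restrict_space borel X)"
    and inv: "\<And>\<phi> :: _ \<Rightarrow> real. continuous_on X \<phi> \<Longrightarrow> (\<integral>x. \<phi> (shift_map x) \<partial>\<nu>) = (\<integral>x. \<phi> x \<partial>\<nu>)"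
  shows "\<nu> \<in> invariant_measures X"
proof -
  interpret prob_space \<nu> by fact
  have space: "space \<nu> = X"
    using sets_eq_imp_space_eq[OF sets] by (simp add: space_restrict_space)
  have T [measurable]: "shift_map \<in> \<nu> \<rightarrow>\<^sub>M \<nu>"
    using sets by (rule shift_map_measurable)
  interpret D: prob_space "distr \<nu> \<nu> shift_map"
    by (rule prob_space_distr) measurable
  have "distr \<nu> \<nu> shift_map = \<nu>"
  proof (rule measure_eqI_cylinder)
    fix w
    have "measure (distr \<nu> \<nu> shift_map) (cylinder w) = (\<integral>x. indicator (cylinder w) x \<partial>distr \<nu> \<nu> shift_map)"
      using sets by (intro integral_indicator_cylinder[symmetric]) simp
    also have "\<dots> = (\<integral>x. indicator (cylinder w) (shift_map x) \<partial>\<nu>)"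
      using sets by (intro integral_distr measurable_continuous_on continuous_on_indicator_cylinder) auto
    also have "\<dots> = (\<integral>x. indicator (cylinder w) x \<partial>\<nu>)"
      by (intro inv continuous_on_indicator_cylinder)
    also have "\<dots> = measure \<nu> (cylinder w)"
      using sets by (rule integral_indicator_cylinder)
    finally show "measure (distr \<nu> \<nu> shift_map) (cylinder w) = measure \<nu> (cylinder w)" .
  qed (use sets in \<open>auto intro: D.finite_measure_axioms finite_measure_axioms\<close>)
  then have "emeasure \<nu> (shift_map -` A \<inter> X) = emeasure \<nu> A" if "A \<in> sets \<nu>" for A
    using emeasure_distr[OF T that] space by simp
  then show ?thesis
    using assms by (simp add: invariant_measures_def)
qed

section \<open>Sequential compactness of the invariant measures\<close>

lemma encoding:
  obtains e :: "(nat \<Rightarrow> nat) \<Rightarrow> real" where "continuous_on X e" and "inj_on e X"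
proof -
  obtain k where k: "1 \<le> k" "\<forall>x\<in>X. \<forall>i. x i \<in> {1..k}"
    using alphabet by blast
  \<comment> \<open>Points are read as expansions in base \<open>k + 2\<close> with digits at most
    \<open>k\<close>. The first differing digit then outweighs the whole tail, so \<open>e\<close>
    is strictly increasing for the lexicographic order.\<close>
  define r :: real where "r = 1 / (k + 2)"
  have r: "0 < r" "r < 1" by (simp_all add: r_def)
  define e where "e x = (\<Sum>i. real (x i) * r ^ i)" for x
  have bound: "norm (real (x i) * r ^ i) \<le> real k * r ^ i" if "x \<in> X" for x i
    using k(2) that r by (simp add: abs_mult)
  have sk: "summable (\<lambda>i. real k * r ^ i)"
    using r by (intro summable_mult summable_geometric) simp
  have summable: "summable (\<lambda>i. real (x i) * r ^ i)" if "x \<in> X" for x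
    using bound[OF that] by (intro summable_comparison_test'[OF sk]) auto
  have "uniform_limit X (\<lambda>n x. \<Sum>i<n. real (x i) * r ^ i) e sequentially"
    unfolding e_def by (rule Weierstrass_m_test[OF bound sk])
  then have "continuous_on X e"
    by (rule uniform_limit_theorem[rotated])
      (auto intro!: always_eventually continuous_intros continuous_on_coordinate)
  moreover have less: "e x < e y" if xy: "x \<in> X" "y \<in> X" and eq: "\<And>i. i < m \<Longrightarrow> x i = y i" and "x m < y m"
    for x y m
  proof -
    define d where "d i = (real (y i) - real (x i)) * r ^ i" for i
    have sd: "summable d"
      unfolding d_def left_diff_distrib using xy by (intro summable_diff summable)
    have "e y - e x = (\<Sum>i. d i)"
      unfolding e_def d_def left_diff_distrib using xy by (intro suminf_diff summable)
    also have "\<dots> = (\<Sum>i. d (i + Suc m)) + (\<Sum>i<Suc m. d i)"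
      using sd by (rule suminf_split_initial_segment)
    also have "(\<Sum>i<Suc m. d i) = d m"
      using eq by (simp add: d_def)
    finally have e: "e y - e x = (\<Sum>i. d (i + Suc m)) + d m" .
    have g: "(\<lambda>i. (- real k * r ^ Suc m) * r ^ i) sums ((- real k * r ^ Suc m) * (1 / (1 - r)))"
      using r by (intro sums_mult geometric_sums) simp
    have sd': "summable (\<lambda>i. d (i + Suc m))"
      using sd by (rule summable_ignore_initial_segment)
    have "(\<Sum>i. (- real k * r ^ Suc m) * r ^ i) \<le> (\<Sum>i. d (i + Suc m))"
    proof (rule suminf_le)
      fix i
      have "- real k \<le> real (y (i + Suc m)) - real (x (i + Suc m))"
      proof -
        have "x (i + Suc m) \<le> k" using k(2) xy by auto
        then show ?thesis by linarith
      qed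
      then have "- real k * r ^ (i + Suc m) \<le> d (i + Suc m)"
        unfolding d_def using r by (intro mult_right_mono) auto
      then show "(- real k * r ^ Suc m) * r ^ i \<le> d (i + Suc m)"
        by (simp add: power_add mult_ac)
    qed (use g sd' in \<open>simp_all add: sums_iff\<close>)
    then have "- real k * r ^ Suc m * (1 / (1 - r)) \<le> (\<Sum>i. d (i + Suc m))"
      using g by (simp add: sums_iff)
    moreover have "r ^ m \<le> d m"
      unfolding d_def using \<open>x m < y m\<close> r by simp
    \<comment> \<open>The geometric tail is \<open>r ^ m\<close> times
      \<open>k * r / (1 - r)\<close>, and \<open>1 - r = (k + 1) * r\<close> makes this factor
      \<open>k / (k + 1)\<close>.\<close>
    moreover have "real k * r ^ Suc m * (1 / (1 - r)) < r ^ m"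
    proof -
      have "1 - r = (real k + 1) * r"
        by (simp add: r_def field_simps)
      then have "real k * r * (1 / (1 - r)) = real k / (real k + 1)"
        using r by simp
      also have "\<dots> < 1" by simp
      finally have "real k * r * (1 / (1 - r)) < 1" .
      then have "r ^ m * (real k * r * (1 / (1 - r))) < r ^ m * 1"
        using r by (intro mult_strict_left_mono) auto
      then show ?thesis by (simp add: mult_ac)
    qed
    ultimately show ?thesis using e by simp
  qed
  have "inj_on e X"
  proof (rule inj_onI, rule ccontr)
    fix x y assume xy: "x \<in> X" "y \<in> X" "e x = e y" "x \<noteq> y"
    define m where "m = (LEAST i. x i \<noteq> y i)"
    have "x m \<noteq> y m"
      unfolding m_def by (rule LeastI_ex) (use xy(4) in blast)
    moreover have "x i = y i" if "i < m" for i
      using not_less_Least[OF that[unfolded m_def]] by simp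
    ultimately show False
      using less[of x y m] less[of y x m] xy by (cases "x m < y m") auto
  qed
  ultimately show ?thesis using that by blast
qed

definition weakly_converges :: "(nat \<Rightarrow> (nat \<Rightarrow> nat) measure) \<Rightarrow> (nat \<Rightarrow> nat) measure \<Rightarrow> bool" where
  "weakly_converges \<mu> \<nu> \<longleftrightarrow>
     (\<forall>\<phi> :: _ \<Rightarrow> real. continuous_on X \<phi> \<longrightarrow> (\<lambda>n. \<integral>x. \<phi> x \<partial>\<mu> n) \<longlonglongrightarrow> (\<integral>x. \<phi> x \<partial>\<nu>))"

lemma weakly_convergesD:
  fixes \<phi> :: "_ \<Rightarrow> real"
  assumes "weakly_converges \<mu> \<nu>" and "continuous_on X \<phi>"
  shows "(\<lambda>n. \<integral>x. \<phi> x \<partial>\<mu> n) \<longlonglongrightarrow> (\<integral>x. \<phi> x \<partial>\<nu>)"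
  using assms unfolding weakly_converges_def by blast

text \<open>
  Compactness is inherited from Helly's selection theorem on the real line through a homeomorphism
  of \<open>X\<close> with a compact set of reals.
\<close>

lemma invariant_measures_seq_compact:
  assumes \<mu>: "\<And>n. \<mu> n \<in> invariant_measures X"
  obtains s \<nu> where "strict_mono (s :: nat \<Rightarrow> nat)" and "\<nu> \<in> invariant_measures X"
    and "weakly_converges (\<lambda>n. \<mu> (s n)) \<nu>"
proof -
  interpret \<mu>: prob_space "\<mu> n" for n using \<mu> by (rule invariant_measureD)
  note sets = invariant_measureD(2)[OF \<mu>] and space = invariant_measureD(3)[OF \<mu>]
  obtain x0 where x0: "x0 \<in> X" using \<mu>.not_empty[of 0] space[of 0] by auto
  obtain e :: "(nat \<Rightarrow> nat) \<Rightarrow> real" where e: "continuous_on X e" "inj_on e X" using encoding by blast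
  define K where "K = e ` X"
  have K: "compact K" "K \<noteq> {}"
    unfolding K_def using compact_continuous_image[OF e(1) compact_X] x0 by blast+
  then have "closed K" by (intro compact_imp_closed)
  then have [measurable]: "K \<in> sets borel" by simp
  obtain d where d: "homeomorphism X K e d"
    using homeomorphism_compact[OF compact_X e(1) K_def[symmetric] e(2)] by blast
  have de: "d (e x) = x" if "x \<in> X" for x
    using d that by (auto simp: homeomorphism_def)
  have [measurable]: "e \<in> borel_measurable (\<mu> n)" for n
    using sets e(1) by (rule measurable_continuous_on)
  define \<rho> where "\<rho> n = distr (\<mu> n) borel e" for n
  have \<rho>: "real_distribution (\<rho> n)" for n
    unfolding \<rho>_def by (rule \<mu>.real_distribution_distr) measurable
  obtain B where B: "\<forall>x\<in>X. \<bar>e x\<bar> \<le> B" using continuous_bounded[OF e(1)] by blast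
  \<comment> \<open>All image measures live in \<open>K\<close>, hence on one bounded interval. The
    margin 1 and the absolute value of \<open>B\<close> keep the half-open interval nondegenerate
    and its left end outside \<open>K\<close>.\<close>
  have "tight \<rho>"
    unfolding tight_def
  proof (intro conjI allI impI \<rho>)
    fix \<epsilon> :: real assume "0 < \<epsilon>"
    have "measure (\<rho> n) {- \<bar>B\<bar> - 1<..\<bar>B\<bar> + 1} = 1" for n
    proof -
      have "e -` {- \<bar>B\<bar> - 1<..\<bar>B\<bar> + 1} \<inter> space (\<mu> n) = space (\<mu> n)"
        using B by (force simp: space)
      then show ?thesis
        by (simp add: \<rho>_def measure_distr \<mu>.prob_space)
    qed
    then show "\<exists>a b. a < b \<and> (\<forall>n. 1 - \<epsilon> < measure (\<rho> n) {a<..b})"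
      using \<open>0 < \<epsilon>\<close> by (intro exI[of _ "- \<bar>B\<bar> - 1"] exI[of _ "\<bar>B\<bar> + 1"]) auto
  qed
  then obtain s M where s: "strict_mono s" and M: "real_distribution M" and conv: "weak_conv_m (\<rho> \<circ> id \<circ> s) M"
    using tight_imp_convergent_subsubsequence[of \<rho> id] by (auto simp: strict_mono_def)
  interpret M: real_distribution M by fact
  have lim: "(\<lambda>n. \<integral>x. g (e x) \<partial>\<mu> (s n)) \<longlonglongrightarrow> (\<integral>y. g y \<partial>M)"
    if g: "continuous_on UNIV g" and bd: "\<And>y. \<bar>g y\<bar> \<le> C" for g :: "real \<Rightarrow> real" and C
  proof -
    have "(\<lambda>n. \<integral>y. g y \<partial>(\<rho> \<circ> id \<circ> s) n) \<longlonglongrightarrow> (\<integral>y. g y \<partial>M)"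
      using g bd \<rho> M conv
      by (intro weak_conv_imp_integral_bdd_continuous_conv[where B=C]) (auto simp: continuous_on_eq_continuous_at comp_def)
    moreover have "(\<integral>y. g y \<partial>\<rho> n) = (\<integral>x. g (e x) \<partial>\<mu> n)" for n
      unfolding \<rho>_def using g by (intro integral_distr) (auto intro: borel_measurable_continuous_onI)
    ultimately show ?thesis by simp
  qed
  \<comment> \<open>Helly's theorem yields a measure on the whole line. The truncated distance to
    \<open>K\<close> is a bounded continuous function with integral zero along the sequence, hence
    also in the limit, so the limit is carried by \<open>K\<close>.\<close>
  have supp: "AE y in M. y \<in> K"
  proof -
    define \<theta> where "\<theta> y = min 1 (infdist y K)" for y
    have cont: "continuous_on UNIV \<theta>"
      unfolding \<theta>_def by (intro continuous_intros)
    have \<theta>: "0 \<le> \<theta> y" "\<bar>\<theta> y\<bar> \<le> 1" for y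
      using infdist_nonneg[of y K] by (auto simp: \<theta>_def)
    have "(\<integral>x. \<theta> (e x) \<partial>\<mu> n) = (\<integral>x. 0 \<partial>\<mu> n)" for n
      by (rule Bochner_Integration.integral_cong) (auto simp: space K_def \<theta>_def)
    with lim[OF cont \<theta>(2)] have zero: "(\<integral>y. \<theta> y \<partial>M) = 0"
      by (simp add: LIMSEQ_const_iff)
    have "\<theta> \<in> borel_measurable M"
      using cont by (simp add: borel_measurable_continuous_onI)
    then have "integrable M \<theta>"
      by (intro M.integrable_const_bound[where B=1] AE_I2) (use \<theta>(2) in simp_all)
    then have "AE y in M. \<theta> y = 0"
      using integral_nonneg_eq_0_iff_AE[of M \<theta>] zero \<theta>(1) by simp
    then show ?thesis
      by eventually_elim
        (use in_closed_iff_infdist_zero[OF \<open>closed K\<close> \<open>K \<noteq> {}\<close>] in \<open>auto simp: \<theta>_def min_def split: if_splits\<close>)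
  qed
  \<comment> \<open>The inverse of \<open>e\<close> is extended by the constant \<open>x0\<close>
    off \<open>K\<close>, an \<open>M\<close>-null set, so that \<open>M\<close> can be pulled back
    to \<open>X\<close>.\<close>
  define d' where "d' y = (if y \<in> K then d y else x0)" for y
  have "d' \<in> borel_measurable borel"
    unfolding d'_def using d
    by (intro borel_measurable_continuous_on_if) (auto simp: homeomorphism_def)
  moreover have "d' y \<in> X" for y
    using d x0 by (auto simp: d'_def homeomorphism_def)
  ultimately have d' [measurable]: "d' \<in> M \<rightarrow>\<^sub>M restrict_space borel X"
    by (intro measurable_restrict_space2) auto
  define \<nu> where "\<nu> = distr M (restrict_space borel X) d'"
  have sets_\<nu>: "sets \<nu> = sets (restrict_space borel X)" by (simp add: \<nu>_def)
  interpret \<nu>: prob_space \<nu>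
    unfolding \<nu>_def by (rule M.prob_space_distr) measurable
  have conv_\<nu>: "(\<lambda>n. \<integral>x. \<phi> x \<partial>\<mu> (s n)) \<longlonglongrightarrow> (\<integral>x. \<phi> x \<partial>\<nu>)"
    if \<phi>: "continuous_on X \<phi>" for \<phi> :: "_ \<Rightarrow> real"
  proof -
    obtain C where C: "0 \<le> C" "\<forall>x\<in>X. \<bar>\<phi> x\<bar> \<le> C" using continuous_bounded[OF \<phi>] by blast
    have "continuous_on K (\<lambda>y. \<phi> (d y))"
      using d by (intro continuous_on_compose2[OF \<phi>]) (auto simp: homeomorphism_def)
    moreover have "norm (\<phi> (d y)) \<le> C" if "y \<in> K" for y
      using d that C by (force simp: homeomorphism_def)
    \<comment> \<open>Tietze's theorem extends the test function from \<open>K\<close> to the line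
      with the same bound, as weak convergence there requires.\<close>
    ultimately obtain g where g: "continuous_on UNIV g" "\<And>y. y \<in> K \<Longrightarrow> g y = \<phi> (d y)" "\<And>y. norm (g y) \<le> C"
      using Tietze[of K "\<lambda>y. \<phi> (d y)" UNIV C] \<open>closed K\<close> C(1) by (auto simp: closed_closedin[symmetric])
    have "(\<lambda>n. \<integral>x. g (e x) \<partial>\<mu> (s n)) \<longlonglongrightarrow> (\<integral>y. g y \<partial>M)"
      by (rule lim[OF g(1) g(3)[unfolded real_norm_def]])
    moreover have "(\<integral>x. g (e x) \<partial>\<mu> n) = (\<integral>x. \<phi> x \<partial>\<mu> n)" for n
      by (rule Bochner_Integration.integral_cong) (auto simp: space K_def g de)
    moreover have "(\<integral>y. g y \<partial>M) = (\<integral>x. \<phi> x \<partial>\<nu>)"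
    proof -
      have "(\<integral>x. \<phi> x \<partial>\<nu>) = (\<integral>y. \<phi> (d' y) \<partial>M)"
        unfolding \<nu>_def using \<phi> by (intro integral_distr borel_measurable_continuous_on_restrict) measurable
      also have "\<dots> = (\<integral>y. g y \<partial>M)"
      proof (rule integral_cong_AE)
        show "(\<lambda>y. \<phi> (d' y)) \<in> borel_measurable M"
          using borel_measurable_continuous_on_restrict[OF \<phi>] by measurable
        show "g \<in> borel_measurable M"
          using g by (simp add: borel_measurable_continuous_onI)
        show "AE y in M. \<phi> (d' y) = g y"
          using supp by eventually_elim (auto simp: d'_def g)
      qed
      finally show ?thesis by simp
    qed
    ultimately show ?thesis by simp
  qed
  have "\<nu> \<in> invariant_measures X"
  proof (rule invariant_measuresI[OF \<nu>.prob_space_axioms sets_\<nu>])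
    fix \<phi> :: "_ \<Rightarrow> real" assume \<phi>: "continuous_on X \<phi>"
    have "(\<integral>x. \<phi> (shift_map x) \<partial>\<mu> n) = (\<integral>x. \<phi> x \<partial>\<mu> n)" for n
    proof -
      interpret P: measure_preserving_map "\<mu> n" shift_map
        using \<mu> by (rule measure_preserving_shift)
      show ?thesis
        using P.integral_iterate[OF measurable_continuous_on[OF sets \<phi>], of 1] by simp
    qed
    moreover have "(\<lambda>n. \<integral>x. \<phi> (shift_map x) \<partial>\<mu> (s n)) \<longlonglongrightarrow> (\<integral>x. \<phi> (shift_map x) \<partial>\<nu>)"
      using continuous_on_iterate_compose[OF \<phi>, of 1] by (intro conv_\<nu>) simp
    ultimately show "(\<integral>x. \<phi> (shift_map x) \<partial>\<nu>) = (\<integral>x. \<phi> x \<partial>\<nu>)"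
      using conv_\<nu>[OF \<phi>] by (simp add: LIMSEQ_unique)
  qed
  with s conv_\<nu> show ?thesis by (intro that) (auto simp: weakly_converges_def)
qed

section \<open>Ergodic measures in closed faces\<close>

text \<open>Since \<open>A\<close> equals its own preimage, intersecting with \<open>A\<close>
  commutes with taking preimages; conditioning on \<open>A\<close> therefore preserves
  invariance.\<close>

lemma uniform_measure_invariant:
  assumes \<nu>: "\<nu> \<in> invariant_measures X" and A: "A \<in> sets \<nu>" "shift_map -` A \<inter> X = A"
    and "measure \<nu> A \<noteq> 0"
  shows "uniform_measure \<nu> A \<in> invariant_measures X"
proof -
  interpret measure_preserving_map \<nu> shift_map
    using \<nu> by (rule measure_preserving_shift)
  note space = invariant_measureD(3)[OF \<nu>]
  have "prob_space (uniform_measure \<nu> A)"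
    using assms by (intro prob_space_uniform_measure) (auto simp: emeasure_eq_measure)
  moreover have "emeasure (uniform_measure \<nu> A) (shift_map -` B \<inter> X) = emeasure (uniform_measure \<nu> A) B"
    if B: "B \<in> sets \<nu>" for B
  proof -
    have TB: "shift_map -` B \<inter> X \<in> sets \<nu>"
      using measurable_sets[OF T_measurable B] by (simp add: space)
    have "A \<inter> (shift_map -` B \<inter> X) = shift_map -` (A \<inter> B) \<inter> X"
      using A(2) by auto
    then show ?thesis
      using A TB B invariant_measureD(4)[OF \<nu>, of "A \<inter> B"] by simp
  qed
  ultimately show ?thesis
    using invariant_measureD(2)[OF \<nu>] by (simp add: invariant_measures_def)
qed

lemma integral_uniform_measure:
  fixes \<phi> :: "_ \<Rightarrow> real"
  assumes "prob_space \<nu>" and A: "A \<in> sets \<nu>" "measure \<nu> A \<noteq> 0" and [measurable]: "\<phi> \<in> borel_measurable \<nu>"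
  shows "measure \<nu> A * (\<integral>x. \<phi> x \<partial>uniform_measure \<nu> A) = (\<integral>x. indicator A x * \<phi> x \<partial>\<nu>)"
proof -
  interpret prob_space \<nu> by fact
  have [measurable]: "A \<in> sets \<nu>" by fact
  have pos: "0 < measure \<nu> A" using A by (simp add: zero_less_measure_iff)
  have "indicator A x / emeasure \<nu> A = ennreal (indicator A x / measure \<nu> A)" for x
    using pos by (auto simp: emeasure_eq_measure divide_ennreal[symmetric] indicator_def)
  then have "uniform_measure \<nu> A = density \<nu> (\<lambda>x. ennreal (indicator A x / measure \<nu> A))"
    by (simp add: uniform_measure_def)
  then have "(\<integral>x. \<phi> x \<partial>uniform_measure \<nu> A) = (\<integral>x. (indicator A x / measure \<nu> A) *\<^sub>R \<phi> x \<partial>\<nu>)"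
    by (simp only:) (intro integral_density; use pos in auto)
  also have "\<dots> = (\<integral>x. indicator A x * \<phi> x \<partial>\<nu>) / measure \<nu> A"
    by simp
  finally show ?thesis using pos by simp
qed

text \<open>
  A strictly convex continuous functional on the space of invariant measures: a maximum on a
  closed face is an extreme point, that is, ergodic.
\<close>

definition cylinder_energy :: "(nat \<Rightarrow> nat) measure \<Rightarrow> real" where
  "cylinder_energy \<mu> = (\<Sum>k. (1 / 2) ^ k * (measure \<mu> (cylinder (from_nat k)))\<^sup>2)"

lemma cylinder_energy_term_le:
  assumes "prob_space \<mu>"
  shows "norm ((1 / 2) ^ k * (measure \<mu> (cylinder (from_nat k)))\<^sup>2) \<le> (1 / 2) ^ k"
  using prob_space.prob_le_1[OF assms, of "cylinder (from_nat k)"]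
  by (simp add: abs_mult power_le_one mult_left_le)

lemma cylinder_energy_summable:
  assumes "prob_space \<mu>"
  shows "summable (\<lambda>k. (1 / 2) ^ k * (measure \<mu> (cylinder (from_nat k)))\<^sup>2)"
  by (rule summable_comparison_test'[OF summable_geometric[of "1 / 2"]])
    (use cylinder_energy_term_le[OF assms] in auto)

lemma cylinder_energy_le:
  assumes "prob_space \<mu>"
  shows "cylinder_energy \<mu> \<le> 2"
proof -
  have "cylinder_energy \<mu> \<le> (\<Sum>k. (1 / 2) ^ k)"
    unfolding cylinder_energy_def using cylinder_energy_term_le[OF assms]
    by (intro suminf_le cylinder_energy_summable assms summable_geometric) (auto intro: abs_le_D1)
  then show ?thesis by (simp add: suminf_geometric)
qed

text \<open>Each term converges because cylinder indicators are continuous, and the common majorant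
  \<open>(1 / 2) ^ k\<close> allows limit and sum to be exchanged.\<close>

lemma tendsto_cylinder_energy:
  assumes \<mu>: "\<And>n. \<mu> n \<in> invariant_measures X" and \<nu>: "\<nu> \<in> invariant_measures X"
    and lim: "weakly_converges \<mu> \<nu>"
  shows "(\<lambda>n. cylinder_energy (\<mu> n)) \<longlonglongrightarrow> cylinder_energy \<nu>"
proof -
  have "(\<lambda>n. measure (\<mu> n) (cylinder w)) \<longlonglongrightarrow> measure \<nu> (cylinder w)" for w
    using weakly_convergesD[OF lim continuous_on_indicator_cylinder, of w]
      integral_indicator_cylinder[OF invariant_measureD(2)[OF \<mu>]]
      integral_indicator_cylinder[OF invariant_measureD(2)[OF \<nu>]] by simp
  then have L: "(\<lambda>n. (1 / 2) ^ k * (measure (\<mu> n) (cylinder (from_nat k)))\<^sup>2)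
      \<longlonglongrightarrow> (1 / 2) ^ k * (measure \<nu> (cylinder (from_nat k)))\<^sup>2" for k
    by (intro tendsto_intros)
  have B: "\<forall>\<^sub>F (k, n) in at_top \<times>\<^sub>F sequentially.
      norm ((1 / 2) ^ k * (measure (\<mu> n) (cylinder (from_nat k)))\<^sup>2) \<le> (1 / 2) ^ k"
    using cylinder_energy_term_le[OF invariant_measureD(1)[OF \<mu>]] by (intro always_eventually) auto
  show ?thesis
    unfolding cylinder_energy_def
    by (rule tannerys_theorem[OF L B, THEN conjunct2, THEN conjunct2]) (simp_all add: summable_geometric)
qed

text \<open>The convex combination of measures, expressed through continuous test functions, which
  avoids arithmetic on measures.\<close>

definition is_mixture ::
  "real \<Rightarrow> (nat \<Rightarrow> nat) measure \<Rightarrow> (nat \<Rightarrow> nat) measure \<Rightarrow> (nat \<Rightarrow> nat) measure \<Rightarrow> bool" where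
  "is_mixture t \<nu>1 \<nu>2 \<nu> \<longleftrightarrow> (\<forall>\<phi> :: _ \<Rightarrow> real. continuous_on X \<phi> \<longrightarrow>
     (\<integral>x. \<phi> x \<partial>\<nu>) = t * (\<integral>x. \<phi> x \<partial>\<nu>1) + (1 - t) * (\<integral>x. \<phi> x \<partial>\<nu>2))"

lemma is_mixtureD:
  fixes \<phi> :: "_ \<Rightarrow> real"
  assumes "is_mixture t \<nu>1 \<nu>2 \<nu>" and "continuous_on X \<phi>"
  shows "(\<integral>x. \<phi> x \<partial>\<nu>) = t * (\<integral>x. \<phi> x \<partial>\<nu>1) + (1 - t) * (\<integral>x. \<phi> x \<partial>\<nu>2)"
  using assms unfolding is_mixture_def by blast

lemma is_mixture_swap: "is_mixture t \<nu>1 \<nu>2 \<nu> \<Longrightarrow> is_mixture (1 - t) \<nu>2 \<nu>1 \<nu>"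
  unfolding is_mixture_def by simp

text \<open>The convexity defect of the square is \<open>t * (1 - t) * (p k - q k)\<^sup>2\<close>
  in each term. Cylinders separate the two measures, so at least one term is strictly
  positive.\<close>

lemma cylinder_energy_strictly_convex:
  fixes t :: real
  assumes \<nu>: "\<nu> \<in> invariant_measures X" "\<nu>1 \<in> invariant_measures X" "\<nu>2 \<in> invariant_measures X"
    and t: "0 < t" "t < 1"
    and mixture: "is_mixture t \<nu>1 \<nu>2 \<nu>"
    and "\<nu>1 \<noteq> \<nu>2"
  shows "cylinder_energy \<nu> < t * cylinder_energy \<nu>1 + (1 - t) * cylinder_energy \<nu>2"
proof -
  note P = \<nu>[THEN invariant_measureD(1)] and S = \<nu>[THEN invariant_measureD(2)]
  define a where "a \<mu> k = (1 / 2) ^ k * (measure \<mu> (cylinder (from_nat k)))\<^sup>2" for \<mu> k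
  define p where "p k = measure \<nu>1 (cylinder (from_nat k))" for k
  define q where "q k = measure \<nu>2 (cylinder (from_nat k))" for k
  have sm: "summable (a \<nu>)" "summable (a \<nu>1)" "summable (a \<nu>2)"
    unfolding a_def using P by (auto intro: cylinder_energy_summable)
  define b where "b k = t * a \<nu>1 k + (1 - t) * a \<nu>2 k - a \<nu> k" for k
  have b: "b k = (1 / 2) ^ k * (t * (1 - t) * (p k - q k)\<^sup>2)" for k
  proof -
    have eq: "measure \<nu> (cylinder (from_nat k)) = t * p k + (1 - t) * q k"
      using is_mixtureD[OF mixture continuous_on_indicator_cylinder[of "from_nat k"]] S
      unfolding p_def q_def by (simp only: integral_indicator_cylinder)
    have "b k = (1 / 2) ^ k * (t * (p k)\<^sup>2 + (1 - t) * (q k)\<^sup>2 - (t * p k + (1 - t) * q k)\<^sup>2)"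
      unfolding b_def a_def eq by (simp add: p_def q_def algebra_simps)
    also have "t * (p k)\<^sup>2 + (1 - t) * (q k)\<^sup>2 - (t * p k + (1 - t) * q k)\<^sup>2 = t * (1 - t) * (p k - q k)\<^sup>2"
      by (simp add: power2_eq_square algebra_simps)
    finally show ?thesis .
  qed
  have "\<exists>w. measure \<nu>1 (cylinder w) \<noteq> measure \<nu>2 (cylinder w)"
  proof (rule ccontr)
    assume "\<not> ?thesis"
    then have "\<nu>1 = \<nu>2"
      using P S by (intro measure_eqI_cylinder) (simp_all add: prob_space.finite_measure)
    with \<open>\<nu>1 \<noteq> \<nu>2\<close> show False ..
  qed
  then obtain w where w: "measure \<nu>1 (cylinder w) \<noteq> measure \<nu>2 (cylinder w)" ..
  then have "p (to_nat w) \<noteq> q (to_nat w)"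
    by (simp add: p_def q_def)
  then have "0 < b (to_nat w)"
    using t by (simp add: b)
  moreover have "summable b"
    unfolding b_def using sm by (intro summable_diff summable_add summable_mult)
  moreover have "0 \<le> b k" for k
    using t by (simp add: b)
  ultimately have "0 < (\<Sum>k. b k)"
    by (intro suminf_pos2) auto
  also have "b sums (t * cylinder_energy \<nu>1 + (1 - t) * cylinder_energy \<nu>2 - cylinder_energy \<nu>)"
    unfolding cylinder_energy_def a_def[symmetric] b_def using sm
    by (intro sums_diff sums_add sums_mult summable_sums)
  then have "(\<Sum>k. b k) = t * cylinder_energy \<nu>1 + (1 - t) * cylinder_energy \<nu>2 - cylinder_energy \<nu>"
    by (simp add: sums_iff)
  finally show ?thesis by simp
qed

text \<open>By compactness the energy attains its maximum on \<open>F\<close>. A maximiser that is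
  not ergodic splits along an invariant set \<open>A\<close> of intermediate measure into two
  different conditional measures. Both lie in \<open>F\<close>, so strict convexity would put the
  energy of the maximiser below the maximum.\<close>

lemma closed_face_contains_ergodic:
  assumes sub: "F \<subseteq> invariant_measures X" and "F \<noteq> {}"
    and closed: "\<And>\<mu> \<nu>. \<forall>n. \<mu> n \<in> F \<Longrightarrow> \<nu> \<in> invariant_measures X \<Longrightarrow> weakly_converges \<mu> \<nu> \<Longrightarrow> \<nu> \<in> F"
    and face: "\<And>\<nu> \<nu>1 \<nu>2 t. \<nu> \<in> F \<Longrightarrow> \<nu>1 \<in> invariant_measures X \<Longrightarrow> \<nu>2 \<in> invariant_measures X \<Longrightarrow>
      0 < t \<Longrightarrow> t < 1 \<Longrightarrow> is_mixture t \<nu>1 \<nu>2 \<nu> \<Longrightarrow> \<nu>1 \<in> F"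
  shows "\<exists>\<nu>\<in>F. \<nu> \<in> ergodic_measures X"
proof -
  define S where "S = Sup (cylinder_energy ` F)"
  have bdd: "bdd_above (cylinder_energy ` F)"
    using sub cylinder_energy_le invariant_measureD(1) by (intro bdd_aboveI2[where M=2]) blast
  have S: "cylinder_energy \<mu> \<le> S" if "\<mu> \<in> F" for \<mu>
    unfolding S_def using that bdd by (intro cSup_upper) auto
  have "\<exists>\<mu>\<in>F. S - 1 / Suc n < cylinder_energy \<mu>" for n
  proof -
    have "S - 1 / Suc n < Sup (cylinder_energy ` F)" by (simp add: S_def)
    then have "\<exists>y\<in>cylinder_energy ` F. S - 1 / Suc n < y"
      using \<open>F \<noteq> {}\<close> by (intro less_cSupD) auto
    then show ?thesis by blast
  qed
  then obtain \<mu> where \<mu>: "\<And>n. \<mu> n \<in> F" "\<And>n. S - 1 / Suc n < cylinder_energy (\<mu> n)"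
    by metis
  have \<mu>_inv: "\<mu> n \<in> invariant_measures X" for n
    using \<mu>(1) sub by blast
  obtain s \<nu> where s: "strict_mono (s :: nat \<Rightarrow> nat)" and \<nu>: "\<nu> \<in> invariant_measures X"
    and conv: "weakly_converges (\<lambda>n. \<mu> (s n)) \<nu>"
    using invariant_measures_seq_compact[of \<mu>, OF \<mu>_inv] by blast
  have \<nu>F: "\<nu> \<in> F"
    by (rule closed[OF _ \<nu> conv]) (use \<mu>(1) in blast)
  have "(\<lambda>n. S - 1 / Suc n) \<longlonglongrightarrow> S - 0"
    by (intro tendsto_diff tendsto_const LIMSEQ_Suc lim_const_over_n)
  then have "(\<lambda>n. S - 1 / Suc (s n)) \<longlonglongrightarrow> S - 0"
    using s by (rule LIMSEQ_subseq_LIMSEQ[unfolded comp_def])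
  moreover have "(\<lambda>n. cylinder_energy (\<mu> (s n))) \<longlonglongrightarrow> cylinder_energy \<nu>"
    using \<mu>_inv \<nu> conv by (rule tendsto_cylinder_energy)
  ultimately have max: "S \<le> cylinder_energy \<nu>"
    using \<mu>(2) by (intro LIMSEQ_le[where X="\<lambda>n. S - 1 / Suc (s n)"]) (auto intro: less_imp_le)
  interpret measure_preserving_map \<nu> shift_map
    using \<nu> by (rule measure_preserving_shift)
  note space = invariant_measureD(3)[OF \<nu>]
  have "\<nu> \<in> ergodic_measures X"
  proof (rule ccontr)
    assume "\<not> ?thesis"
    then obtain A where A: "A \<in> sets \<nu>" "shift_map -` A \<inter> X = A" "emeasure \<nu> A \<noteq> 0" "emeasure \<nu> A \<noteq> 1"
      using \<nu> by (auto simp: ergodic_measures_def)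
    define t where "t = measure \<nu> A"
    have "t \<noteq> 0" "t \<noteq> 1" "0 \<le> t" "t \<le> 1"
      using A by (auto simp: t_def emeasure_eq_measure)
    then have t: "0 < t" "t < 1" by auto
    define A' where "A' = X - A"
    have A': "A' \<in> sets \<nu>" "shift_map -` A' \<inter> X = A'" "measure \<nu> A' = 1 - t"
      using A prob_compl[OF A(1)] shift_map_X by (auto simp: A'_def t_def space[symmetric])
    define \<nu>1 where "\<nu>1 = uniform_measure \<nu> A"
    define \<nu>2 where "\<nu>2 = uniform_measure \<nu> A'"
    have inv: "\<nu>1 \<in> invariant_measures X" "\<nu>2 \<in> invariant_measures X"
      unfolding \<nu>1_def \<nu>2_def using A A' t by (auto intro!: uniform_measure_invariant \<nu> simp: t_def[symmetric])
    have "(\<integral>x. \<phi> x \<partial>\<nu>) = t * (\<integral>x. \<phi> x \<partial>\<nu>1) + (1 - t) * (\<integral>x. \<phi> x \<partial>\<nu>2)"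
      if \<phi>: "continuous_on X \<phi>" for \<phi> :: "_ \<Rightarrow> real"
    proof -
      have m: "\<phi> \<in> borel_measurable \<nu>"
        using invariant_measureD(2)[OF \<nu>] \<phi> by (rule measurable_continuous_on)
      have int: "integrable \<nu> \<phi>" using \<nu> \<phi> by (rule integrable_continuous_on)
      have "(\<integral>x. \<phi> x \<partial>\<nu>) = (\<integral>x. indicator A x * \<phi> x + indicator A' x * \<phi> x \<partial>\<nu>)"
        by (rule Bochner_Integration.integral_cong) (auto simp: A'_def space indicator_def)
      also have "\<dots> = (\<integral>x. indicator A x * \<phi> x \<partial>\<nu>) + (\<integral>x. indicator A' x * \<phi> x \<partial>\<nu>)"
        using integrable_mult_indicator[OF A(1) int] integrable_mult_indicator[OF A'(1) int]
        by (intro Bochner_Integration.integral_add) simp_all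
      also have "(\<integral>x. indicator A x * \<phi> x \<partial>\<nu>) = t * (\<integral>x. \<phi> x \<partial>\<nu>1)"
        using integral_uniform_measure[OF prob_space_axioms A(1) _ m] t by (simp add: t_def \<nu>1_def)
      also have "(\<integral>x. indicator A' x * \<phi> x \<partial>\<nu>) = (1 - t) * (\<integral>x. \<phi> x \<partial>\<nu>2)"
        using integral_uniform_measure[OF prob_space_axioms A'(1) _ m] t A'(3) by (simp add: \<nu>2_def)
      finally show ?thesis .
    qed
    then have mixture: "is_mixture t \<nu>1 \<nu>2 \<nu>"
      by (simp add: is_mixture_def)
    have "emeasure \<nu>1 A \<noteq> 0"
      using A t by (simp add: \<nu>1_def emeasure_uniform_measure_1)
    moreover have "A' \<inter> A = {}"
      by (auto simp: A'_def)
    then have "emeasure \<nu>2 A = 0"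
      using A A' by (simp add: \<nu>2_def)
    ultimately have "\<nu>1 \<noteq> \<nu>2" by auto
    then have "cylinder_energy \<nu> < t * cylinder_energy \<nu>1 + (1 - t) * cylinder_energy \<nu>2"
      using cylinder_energy_strictly_convex[OF \<nu> inv t mixture] by simp
    \<comment> \<open>The face property speaks of the first component only; the second is reached
      through the swapped mixture.\<close>
    moreover have "\<nu>1 \<in> F" "\<nu>2 \<in> F"
      using face[OF \<nu>F inv t mixture] face[OF \<nu>F inv(2,1) _ _ is_mixture_swap[OF mixture]] t by auto
    then have "t * cylinder_energy \<nu>1 + (1 - t) * cylinder_energy \<nu>2 \<le> t * S + (1 - t) * S"
      using t S by (intro add_mono mult_left_mono) auto
    ultimately show False
      using max by (simp add: algebra_simps)
  qed
  with \<nu>F show ?thesis by blast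
qed

section \<open>From ergodic to arbitrary invariant measures\<close>

lemma continuous_subadditive_process:
  assumes "\<mu> \<in> invariant_measures X"
    and g: "\<And>n. continuous_on X (g n)" "\<And>x. x \<in> X \<Longrightarrow> g 0 x = 0"
      "\<And>n m x. x \<in> X \<Longrightarrow> g (n + m) x \<le> g n x + g m ((shift_map ^^ n) x)"
  shows "subadditive_process \<mu> shift_map g"
proof -
  interpret measure_preserving_map \<mu> shift_map
    using assms(1) by (rule measure_preserving_shift)
  note D = invariant_measureD[OF assms(1)]
  show ?thesis
  proof (unfold_locales, goal_cases)
    case (1 n)
    show ?case using D(2) g(1) by (rule measurable_continuous_on)
  next
    case (2 n)
    show ?case using continuous_bounded[OF g(1)[of n]] D(3) by metis
  qed (use g D(3) in auto)
qed

text \<open>\<open>\<beta>\<close> is the largest slope that some invariant measure sustains at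
  every index. The measures sustaining it form a closed face, nonempty by compactness, and
  \<open>closed_face_contains_ergodic\<close> picks an ergodic one.\<close>

lemma exists_ergodic_mean_ge:
  fixes g :: "nat \<Rightarrow> (nat \<Rightarrow> nat) \<Rightarrow> real"
  assumes \<mu>: "\<mu> \<in> invariant_measures X" and c: "\<And>n. real n * c \<le> (\<integral>x. g n x \<partial>\<mu>)"
    and g: "\<And>n. continuous_on X (g n)" "\<And>x. x \<in> X \<Longrightarrow> g 0 x = 0"
      "\<And>n m x. x \<in> X \<Longrightarrow> g (n + m) x \<le> g n x + g m ((shift_map ^^ n) x)"
  shows "\<exists>\<nu>\<in>ergodic_measures X. \<forall>n. real n * c \<le> (\<integral>x. g n x \<partial>\<nu>)"
proof -
  \<comment> \<open>Demanding the bound at every single \<open>n\<close>, rather than of the limit,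
    makes the condition stable under weak limits.\<close>
  define P where "P b = {\<nu> \<in> invariant_measures X. \<forall>n. real n * b \<le> (\<integral>x. g n x \<partial>\<nu>)}" for b
  define \<beta> where "\<beta> = Sup {b. P b \<noteq> {}}"
  have process: "subadditive_process \<nu> shift_map g" if "\<nu> \<in> invariant_measures X" for \<nu>
    using that g by (rule continuous_subadditive_process)
  have mem: "\<mu> \<in> P c" using \<mu> c by (auto simp: P_def)
  obtain C where C: "\<forall>x\<in>X. \<bar>g 1 x\<bar> \<le> C" using continuous_bounded[OF g(1)[of 1]] by blast
  have "b \<le> C" if "\<nu> \<in> P b" for \<nu> b
  proof -
    have \<nu>: "\<nu> \<in> invariant_measures X" "b \<le> (\<integral>x. g 1 x \<partial>\<nu>)"
      using that by (auto simp: P_def dest!: spec[where x=1])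
    interpret prob_space \<nu> using \<nu>(1) by (rule invariant_measureD)
    have "(\<integral>x. g 1 x \<partial>\<nu>) \<le> (\<integral>x. C \<partial>\<nu>)"
      using C invariant_measureD(3)[OF \<nu>(1)]
      by (intro integral_mono integrable_continuous_on[OF \<nu>(1)] g) (auto intro: abs_le_D1)
    with \<nu>(2) show ?thesis by (simp add: prob_space)
  qed
  then have bdd: "bdd_above {b. P b \<noteq> {}}" by (intro bdd_aboveI[where M=C]) auto
  have le_\<beta>: "b \<le> \<beta>" if "\<nu> \<in> P b" for \<nu> b
    unfolding \<beta>_def using that bdd by (intro cSup_upper) auto
  \<comment> \<open>The slopes may vary along the sequence: this serves the maximising sequence as
    well as the closedness of \<open>P \<beta>\<close>, where they are constant.\<close>
  have closed: "\<nu> \<in> P \<beta>"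
    if \<nu>: "\<nu> \<in> invariant_measures X" and b: "b \<longlonglongrightarrow> \<beta>" and \<mu>s: "\<forall>n. \<mu>s n \<in> P (b n)"
      and lim: "weakly_converges \<mu>s \<nu>"
    for \<nu> b \<mu>s
  proof -
    have "real m * \<beta> \<le> (\<integral>x. g m x \<partial>\<nu>)" for m
    proof (rule LIMSEQ_le[OF _ weakly_convergesD[OF lim g(1)]])
      show "(\<lambda>n. real m * b n) \<longlonglongrightarrow> real m * \<beta>"
        using b by (intro tendsto_intros)
      show "\<exists>N. \<forall>n\<ge>N. real m * b n \<le> (\<integral>x. g m x \<partial>\<mu>s n)"
        using \<mu>s by (auto simp: P_def)
    qed
    with \<nu> show ?thesis by (simp add: P_def)
  qed
  have "\<exists>b \<nu>. \<beta> - 1 / Suc n < b \<and> \<nu> \<in> P b" for n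
  proof -
    have "\<beta> - 1 / Suc n < Sup {b. P b \<noteq> {}}" by (simp add: \<beta>_def)
    moreover have "{b. P b \<noteq> {}} \<noteq> {}" using mem by blast
    ultimately have "\<exists>b\<in>{b. P b \<noteq> {}}. \<beta> - 1 / Suc n < b" by (intro less_cSupD)
    then show ?thesis by blast
  qed
  then obtain b \<mu>s where b: "\<And>n. \<beta> - 1 / Suc n < b n" and \<mu>s: "\<And>n. \<mu>s n \<in> P (b n)"
    by metis
  have "P \<beta> \<noteq> {}"
  proof -
    have "\<mu>s n \<in> invariant_measures X" for n
      using \<mu>s[of n] by (simp add: P_def)
    then obtain s \<nu> where s: "strict_mono (s :: nat \<Rightarrow> nat)" and \<nu>: "\<nu> \<in> invariant_measures X"
      and conv: "weakly_converges (\<lambda>n. \<mu>s (s n)) \<nu>"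
      using invariant_measures_seq_compact[of \<mu>s] by metis
    have "(\<lambda>n. \<beta> - 1 / Suc n) \<longlonglongrightarrow> \<beta> - 0"
      by (intro tendsto_diff tendsto_const LIMSEQ_Suc lim_const_over_n)
    then have "(\<lambda>n. \<beta> - 1 / Suc n) \<longlonglongrightarrow> \<beta>" by simp
    then have "b \<longlonglongrightarrow> \<beta>"
    proof (rule tendsto_sandwich[OF _ _ _ tendsto_const, rotated 2])
      show "\<forall>\<^sub>F n in sequentially. \<beta> - 1 / Suc n \<le> b n"
        using b by (intro always_eventually) (auto intro: less_imp_le)
      show "\<forall>\<^sub>F n in sequentially. b n \<le> \<beta>"
        using le_\<beta>[OF \<mu>s] by (intro always_eventually) auto
    qed
    then have "(\<lambda>n. b (s n)) \<longlonglongrightarrow> \<beta>"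
      using s by (rule LIMSEQ_subseq_LIMSEQ[unfolded comp_def])
    then have "\<nu> \<in> P \<beta>"
      by (rule closed[OF \<nu> _ _ conv]) (use \<mu>s in blast)
    then show ?thesis by blast
  qed
  \<comment> \<open>By maximality of \<open>\<beta>\<close> no invariant measure sustains the slope
    \<open>\<beta> + \<delta> / 2\<close>; some mean falls below it, and
    \<open>mean_le_average\<close> carries this to all large \<open>n\<close>.\<close>
  have mean_lt: "\<forall>\<^sub>F n in sequentially. (\<integral>x. g n x \<partial>\<nu>) / n < \<beta> + \<delta>"
    if \<nu>: "\<nu> \<in> invariant_measures X" and "0 < \<delta>" for \<nu> \<delta>
  proof -
    interpret subadditive_process \<nu> shift_map g using \<nu> by (rule process)
    have "\<nu> \<notin> P (\<beta> + \<delta> / 2)" using le_\<beta>[of \<nu> "\<beta> + \<delta> / 2"] \<open>0 < \<delta>\<close> by auto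
    then obtain m where m: "(\<integral>x. g m x \<partial>\<nu>) < real m * (\<beta> + \<delta> / 2)"
      using \<nu> by (auto simp: P_def not_le)
    then have "1 \<le> m" using integral_g_zero by (cases m) auto
    have "(\<integral>x. g m x \<partial>\<nu>) / m + \<delta> / 2 < \<beta> + \<delta>"
      using m \<open>1 \<le> m\<close> by (simp add: field_simps)
    moreover have "\<forall>\<^sub>F n in sequentially. (\<integral>x. g n x \<partial>\<nu>) / n < (\<integral>x. g m x \<partial>\<nu>) / m + \<delta> / 2"
      using \<open>1 \<le> m\<close> \<open>0 < \<delta>\<close> by (intro mean_le_average) auto
    ultimately show ?thesis by (auto elim: eventually_mono)
  qed
  have face: "\<nu>1 \<in> P \<beta>"
    if \<nu>: "\<nu> \<in> P \<beta>" and \<nu>1: "\<nu>1 \<in> invariant_measures X" and \<nu>2: "\<nu>2 \<in> invariant_measures X"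
      and t: "0 < t" "t < 1"
      and mixture: "is_mixture t \<nu>1 \<nu>2 \<nu>" for \<nu> \<nu>1 \<nu>2 t
  proof (rule ccontr)
    assume "\<nu>1 \<notin> P \<beta>"
    interpret subadditive_process \<nu>1 shift_map g using \<nu>1 by (rule process)
    obtain m where m: "(\<integral>x. g m x \<partial>\<nu>1) < real m * \<beta>"
      using \<open>\<nu>1 \<notin> P \<beta>\<close> \<nu>1 by (auto simp: P_def not_le)
    then have "1 \<le> m" using integral_g_zero by (cases m) auto
    \<comment> \<open>Half the shortfall of \<open>\<nu>1\<close> at index \<open>m\<close>, so that
      its normalised means are eventually below \<open>\<beta> - \<eta>\<close>.\<close>
    define \<eta> where "\<eta> = (\<beta> - (\<integral>x. g m x \<partial>\<nu>1) / m) / 2"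
    have \<eta>: "0 < \<eta>" using m \<open>1 \<le> m\<close> by (simp add: \<eta>_def field_simps)
    have eq: "(\<integral>x. g m x \<partial>\<nu>1) / m + \<eta> = \<beta> - \<eta>" by (simp add: \<eta>_def field_simps)
    have "\<forall>\<^sub>F n in sequentially. (\<integral>x. g n x \<partial>\<nu>1) / n < \<beta> - \<eta>"
      using mean_le_average[OF \<open>1 \<le> m\<close> \<eta>] unfolding eq .
    \<comment> \<open>The excess \<open>t * \<eta>\<close> granted to \<open>\<nu>2\<close> is too
      small to make up for the loss: the mixture ends below
      \<open>\<beta> - t * t * \<eta>\<close>.\<close>
    moreover have "\<forall>\<^sub>F n in sequentially. (\<integral>x. g n x \<partial>\<nu>2) / n < \<beta> + t * \<eta>"
      using \<nu>2 t \<eta> by (intro mean_lt) auto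
    ultimately have "\<forall>\<^sub>F n in sequentially. False"
      using eventually_gt_at_top[of 0]
    proof eventually_elim
      case (elim n)
      have "\<beta> \<le> (\<integral>x. g n x \<partial>\<nu>) / n"
        using \<nu> elim by (simp add: P_def field_simps)
      also have "\<dots> = t * ((\<integral>x. g n x \<partial>\<nu>1) / n) + (1 - t) * ((\<integral>x. g n x \<partial>\<nu>2) / n)"
        using is_mixtureD[OF mixture g(1)[of n]] by (simp add: add_divide_distrib)
      also have "\<dots> < t * (\<beta> - \<eta>) + (1 - t) * (\<beta> + t * \<eta>)"
        using elim t by (intro add_strict_mono mult_strict_left_mono) auto
      also have "\<dots> = \<beta> - t * t * \<eta>"
        by (simp add: algebra_simps)
      finally have "t * t * \<eta> < 0" by simp
      moreover have "0 < t * t * \<eta>" using t \<eta> by simp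
      ultimately show ?case by linarith
    qed
    then show False by simp
  qed
  have "\<exists>\<nu>\<in>P \<beta>. \<nu> \<in> ergodic_measures X"
  proof (rule closed_face_contains_ergodic)
    show "P \<beta> \<subseteq> invariant_measures X" by (auto simp: P_def)
    show "P \<beta> \<noteq> {}" by fact
    show "\<nu> \<in> P \<beta>" if "\<forall>n. \<mu>' n \<in> P \<beta>" "\<nu> \<in> invariant_measures X" "weakly_converges \<mu>' \<nu>" for \<mu>' \<nu>
      by (rule closed[OF that(2) tendsto_const that(1,3)])
  qed (rule face)
  then obtain \<nu> where \<nu>: "\<nu> \<in> P \<beta>" "\<nu> \<in> ergodic_measures X" by blast
  have "real n * c \<le> (\<integral>x. g n x \<partial>\<nu>)" for n
  proof -
    have "real n * c \<le> real n * \<beta>"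
      using le_\<beta>[OF mem] by (intro mult_left_mono) auto
    also have "\<dots> \<le> (\<integral>x. g n x \<partial>\<nu>)"
      using \<nu>(1) by (simp add: P_def)
    finally show ?thesis .
  qed
  with \<nu>(2) show ?thesis by blast
qed

text \<open>A positive or negative deviation of the means under \<open>\<mu>\<close> is transferred
  by \<open>exists_ergodic_mean_ge\<close> to an ergodic measure, where it contradicts the
  assumption.\<close>

lemma mean_lim_zero_of_ergodic:
  fixes g :: "nat \<Rightarrow> (nat \<Rightarrow> nat) \<Rightarrow> real"
  assumes erg: "\<And>\<nu>. \<nu> \<in> ergodic_measures X \<Longrightarrow> (\<lambda>n. (\<integral>x. g n x \<partial>\<nu>) / n) \<longlonglongrightarrow> 0"
    and \<mu>: "\<mu> \<in> invariant_measures X"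
    and g: "\<And>n. continuous_on X (g n)" "\<And>x. x \<in> X \<Longrightarrow> g 0 x = 0"
      "\<And>n m x. x \<in> X \<Longrightarrow> g (n + m) x \<le> g n x + g m ((shift_map ^^ n) x)"
  shows "(\<lambda>n. (\<integral>x. g n x \<partial>\<mu>) / n) \<longlonglongrightarrow> 0"
proof -
  interpret subadditive_process \<mu> shift_map g
    using \<mu> g by (rule continuous_subadditive_process)
  have nonneg: "0 \<le> (\<integral>x. g N x \<partial>\<mu>)" for N
  proof (rule ccontr)
    assume neg: "\<not> ?thesis"
    then have "1 \<le> N" using integral_g_zero by (cases N) auto
    define c where "c = - (\<integral>x. g N x \<partial>\<mu>)"
    have "0 < c" using neg by (simp add: c_def)
    \<comment> \<open>The transfer keeps lower bounds only, and \<open>- g\<close> is in general not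
      subadditive. The orbit sums of \<open>- g N\<close> are additive, and their means under any
      invariant measure are exact multiples of the first, so the slope \<open>c\<close> is sustained
      at every index.\<close>
    define \<phi> where "\<phi> x = - g N x" for x
    have \<phi>: "continuous_on X \<phi>" unfolding \<phi>_def by (intro continuous_intros g)
    obtain C where C: "\<forall>x\<in>X. \<bar>\<phi> x\<bar> \<le> C" using continuous_bounded[OF \<phi>] by blast
    have orbit: "(\<integral>x. (\<Sum>i<n. \<phi> ((shift_map ^^ i) x)) \<partial>\<nu>) = real n * (\<integral>x. \<phi> x \<partial>\<nu>)"
      if \<nu>: "\<nu> \<in> invariant_measures X" for \<nu> n
    proof -
      interpret \<nu>: measure_preserving_map \<nu> shift_map
        using \<nu> by (rule measure_preserving_shift)
      show ?thesis
        using C invariant_measureD[OF \<nu>] \<phi>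
        by (intro \<nu>.integral_orbit_sum[where C=C] measurable_continuous_on) auto
    qed
    have "\<exists>\<nu>\<in>ergodic_measures X. \<forall>n. real n * c \<le> (\<integral>x. (\<Sum>i<n. \<phi> ((shift_map ^^ i) x)) \<partial>\<nu>)"
    proof (rule exists_ergodic_mean_ge[OF \<mu>])
      show "real n * c \<le> (\<integral>x. (\<Sum>i<n. \<phi> ((shift_map ^^ i) x)) \<partial>\<mu>)" for n
        unfolding orbit[OF \<mu>] by (simp add: c_def \<phi>_def[abs_def])
      show "continuous_on X (\<lambda>x. \<Sum>i<n. \<phi> ((shift_map ^^ i) x))" for n
        by (intro continuous_on_sum continuous_on_iterate_compose \<phi>)
      show "(\<Sum>i<n + m. \<phi> ((shift_map ^^ i) x))
          \<le> (\<Sum>i<n. \<phi> ((shift_map ^^ i) x)) + (\<Sum>i<m. \<phi> ((shift_map ^^ i) ((shift_map ^^ n) x)))" for n m x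
        by (simp add: orbit_sum_add)
    qed simp
    then obtain \<nu> where \<nu>: "\<nu> \<in> ergodic_measures X" "\<And>n. real n * c \<le> (\<integral>x. (\<Sum>i<n. \<phi> ((shift_map ^^ i) x)) \<partial>\<nu>)"
      by blast
    then have \<nu>_inv: "\<nu> \<in> invariant_measures X" by (simp add: ergodic_measures_def)
    interpret \<nu>: subadditive_process \<nu> shift_map g
      using \<nu>_inv g by (rule continuous_subadditive_process)
    have "c \<le> - (\<integral>x. g N x \<partial>\<nu>)"
      using \<nu>(2)[of 1] unfolding orbit[OF \<nu>_inv] by (simp add: \<phi>_def[abs_def])
    moreover have "0 \<le> (\<integral>x. g N x \<partial>\<nu>)"
      using \<nu>.mean_nonneg_of_lim_zero[OF erg[OF \<nu>(1)]] .
    ultimately show False using \<open>0 < c\<close> by simp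
  qed
  show ?thesis
  proof (rule tendstoI)
    fix \<epsilon> :: real assume "0 < \<epsilon>"
    have "\<exists>N. (\<integral>x. g N x \<partial>\<mu>) < real N * (\<epsilon> / 2)"
    proof (rule ccontr)
      assume "\<not> ?thesis"
      then have "real n * (\<epsilon> / 2) \<le> (\<integral>x. g n x \<partial>\<mu>)" for n by (auto simp: not_less)
      from exists_ergodic_mean_ge[OF \<mu> this g] obtain \<nu> where \<nu>: "\<nu> \<in> ergodic_measures X"
        "\<And>n. real n * (\<epsilon> / 2) \<le> (\<integral>x. g n x \<partial>\<nu>)" by blast
      have "\<forall>\<^sub>F n in sequentially. (\<integral>x. g n x \<partial>\<nu>) / n < \<epsilon> / 2"
        using \<open>0 < \<epsilon>\<close> by (intro order_tendstoD(2)[OF erg[OF \<nu>(1)]]) simp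
      then have "\<forall>\<^sub>F n in sequentially. False"
        using eventually_gt_at_top[of 0]
      proof eventually_elim
        case (elim n)
        with \<nu>(2)[of n] show ?case by (simp add: field_simps)
      qed
      then show False by simp
    qed
    then obtain N where N: "(\<integral>x. g N x \<partial>\<mu>) < real N * (\<epsilon> / 2)" ..
    then have "1 \<le> N" using integral_g_zero by (cases N) auto
    have N_lt: "(\<integral>x. g N x \<partial>\<mu>) / N < \<epsilon> / 2"
      using N \<open>1 \<le> N\<close> by (simp add: field_simps)
    have "\<forall>\<^sub>F n in sequentially. (\<integral>x. g n x \<partial>\<mu>) / n < (\<integral>x. g N x \<partial>\<mu>) / N + \<epsilon> / 2"
      using \<open>1 \<le> N\<close> \<open>0 < \<epsilon>\<close> by (intro mean_le_average) auto
    then show "\<forall>\<^sub>F n in sequentially. dist ((\<integral>x. g n x \<partial>\<mu>) / n) 0 < \<epsilon>"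
    proof eventually_elim
      case (elim n)
      then have "(\<integral>x. g n x \<partial>\<mu>) / n < \<epsilon>" using N_lt by linarith
      then show ?case using nonneg[of n] by (simp add: dist_real_def)
    qed
  qed
qed

end

section \<open>Equivalence of the three conditions\<close>

theorem proposition3p1:
  fixes X :: "(nat \<Rightarrow> nat) set"
    and f :: "nat \<Rightarrow> (nat \<Rightarrow> nat) \<Rightarrow> real"
    and h :: "(nat \<Rightarrow> nat) \<Rightarrow> real"
  assumes "subshift X"
    and "subadditive_sequence X f"
    and "continuous_on X h"
  defines "cond_i \<equiv> \<forall>\<mu>\<in>invariant_measures X.
      (\<lambda>n. (1 / real n) * (\<integral>x. ln (f n x) \<partial>\<mu>)) \<longlonglongrightarrow> (\<integral>x. h x \<partial>\<mu>)"
    and "cond_ii \<equiv> \<forall>\<mu>\<in>ergodic_measures X.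
      (\<lambda>n. (1 / real n) * (\<integral>x. ln (f n x) \<partial>\<mu>)) \<longlonglongrightarrow> (\<integral>x. h x \<partial>\<mu>)"
    and "cond_iii \<equiv> \<forall>\<mu>\<in>ergodic_measures X.
      AE x in \<mu>. (\<lambda>n. (1 / real n) * ln (f n x / exp (birkhoff_sum n h x))) \<longlonglongrightarrow> 0"
  shows "(cond_i \<longleftrightarrow> cond_ii) \<and> (cond_ii \<longleftrightarrow> cond_iii)"
proof -
  interpret subshift_system X by unfold_locales fact
  have f: "\<And>n. 1 \<le> n \<Longrightarrow> continuous_on X (f n)" "\<And>n x. 1 \<le> n \<Longrightarrow> x \<in> X \<Longrightarrow> 0 < f n x"
    "\<And>n m x. 1 \<le> n \<Longrightarrow> 1 \<le> m \<Longrightarrow> x \<in> X \<Longrightarrow> f (n + m) x \<le> f n x * f m ((shift_map ^^ n) x)"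
    using assms(2) unfolding subadditive_sequence_def by auto
  \<comment> \<open>The value at 0 is set by hand because \<open>f 0\<close> is
    unconstrained.\<close>
  define g where "g n x = (if n = 0 then 0 else ln (f n x) - birkhoff_sum n h x)" for n x
  have cont_S: "continuous_on X (birkhoff_sum n h)" for n
    unfolding birkhoff_sum_def[abs_def] by (intro continuous_on_sum continuous_on_iterate_compose assms)
  have cont_ln: "continuous_on X (\<lambda>x. ln (f n x))" if "1 \<le> n" for n
    using f[OF that] by (intro continuous_on_ln) force+
  have g_cont: "continuous_on X (g n)" for n
    by (cases "n = 0") (auto simp: g_def[abs_def] intro!: continuous_on_diff cont_S cont_ln)
  have g_0: "g 0 x = 0" for x by (simp add: g_def)
  have g_subadd: "g (n + m) x \<le> g n x + g m ((shift_map ^^ n) x)" if x: "x \<in> X" for n m x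
  proof (cases "n = 0 \<or> m = 0")
    case False
    then have nm: "1 \<le> n" "1 \<le> m" by auto
    have pos: "0 < f n x" "0 < f m ((shift_map ^^ n) x)" "0 < f (n + m) x"
      using f(2) nm x iterate_shift_map_X[OF x] by auto
    have "ln (f (n + m) x) \<le> ln (f n x * f m ((shift_map ^^ n) x))"
      using f(3)[OF nm x] pos by simp
    also have "\<dots> = ln (f n x) + ln (f m ((shift_map ^^ n) x))"
      using pos by (simp add: ln_mult)
    finally show ?thesis
      using False by (simp add: g_def birkhoff_sum_def orbit_sum_add)
  qed (auto simp: g_def)
  have mean_iff: "(\<lambda>n. (1 / real n) * (\<integral>x. ln (f n x) \<partial>\<mu>)) \<longlonglongrightarrow> (\<integral>x. h x \<partial>\<mu>) \<longleftrightarrow>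
      (\<lambda>n. (\<integral>x. g n x \<partial>\<mu>) / n) \<longlonglongrightarrow> 0" if \<mu>: "\<mu> \<in> invariant_measures X" for \<mu>
  proof -
    interpret measure_preserving_map \<mu> shift_map using \<mu> by (rule measure_preserving_shift)
    obtain C where C: "\<forall>x\<in>X. \<bar>h x\<bar> \<le> C" using continuous_bounded[OF assms(3)] by blast
    have S: "(\<integral>x. birkhoff_sum n h x \<partial>\<mu>) = real n * (\<integral>x. h x \<partial>\<mu>)" for n
      unfolding birkhoff_sum_def using C invariant_measureD[OF \<mu>] assms(3)
      by (intro integral_orbit_sum[where C=C] measurable_continuous_on) auto
    have "(\<integral>x. g n x \<partial>\<mu>) / n = (1 / real n) * (\<integral>x. ln (f n x) \<partial>\<mu>) - (\<integral>x. h x \<partial>\<mu>)" if "1 \<le> n" for n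
    proof -
      have "(\<integral>x. g n x \<partial>\<mu>) = (\<integral>x. ln (f n x) \<partial>\<mu>) - (\<integral>x. birkhoff_sum n h x \<partial>\<mu>)"
        using that integrable_continuous_on[OF \<mu> cont_ln[OF that]] integrable_continuous_on[OF \<mu> cont_S[of n]]
        by (simp add: g_def)
      then show ?thesis
        using that by (simp add: S field_simps)
    qed
    \<comment> \<open>At index 0 the two sequences differ by the integral of \<open>h\<close>, since
      division by zero gives 0; equality from 1 on suffices for the limit.\<close>
    then have "(\<lambda>n. (\<integral>x. g n x \<partial>\<mu>) / n) \<longlonglongrightarrow> 0 \<longleftrightarrow>
        (\<lambda>n. (1 / real n) * (\<integral>x. ln (f n x) \<partial>\<mu>) - (\<integral>x. h x \<partial>\<mu>)) \<longlonglongrightarrow> 0"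
      by (intro tendsto_cong eventually_sequentiallyI[of 1]) auto
    then show ?thesis
      by (simp only: LIM_zero_iff)
  qed
  have erg_inv: "\<mu> \<in> invariant_measures X" if "\<mu> \<in> ergodic_measures X" for \<mu>
    using that by (simp add: ergodic_measures_def)
  have "cond_i" if "cond_ii"
    unfolding cond_i_def
  proof
    fix \<mu> assume \<mu>: "\<mu> \<in> invariant_measures X"
    have "(\<lambda>n. (\<integral>x. g n x \<partial>\<nu>) / n) \<longlonglongrightarrow> 0" if "\<nu> \<in> ergodic_measures X" for \<nu>
      using \<open>cond_ii\<close> mean_iff[OF erg_inv] that unfolding cond_ii_def by blast
    then have "(\<lambda>n. (\<integral>x. g n x \<partial>\<mu>) / n) \<longlonglongrightarrow> 0"
      using \<mu> g_cont g_0 g_subadd by (rule mean_lim_zero_of_ergodic)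
    then show "(\<lambda>n. (1 / real n) * (\<integral>x. ln (f n x) \<partial>\<mu>)) \<longlonglongrightarrow> (\<integral>x. h x \<partial>\<mu>)"
      by (simp only: mean_iff[OF \<mu>])
  qed
  moreover have "cond_ii" if "cond_i"
    using that erg_inv unfolding cond_i_def cond_ii_def by blast
  moreover have "(\<lambda>n. (1 / real n) * (\<integral>x. ln (f n x) \<partial>\<mu>)) \<longlonglongrightarrow> (\<integral>x. h x \<partial>\<mu>) \<longleftrightarrow>
      (AE x in \<mu>. (\<lambda>n. (1 / real n) * ln (f n x / exp (birkhoff_sum n h x))) \<longlonglongrightarrow> 0)"
    if \<mu>: "\<mu> \<in> ergodic_measures X" for \<mu>
  proof -
    interpret ergodic_map \<mu> shift_map using \<mu> by (rule ergodic_shift)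
    interpret subadditive_process \<mu> shift_map g
      using erg_inv[OF \<mu>] g_cont g_0 g_subadd by (rule continuous_subadditive_process)
    interpret ergodic_subadditive_process \<mu> shift_map g ..
    have "(AE x in \<mu>. (\<lambda>n. g n x / n) \<longlonglongrightarrow> 0) \<longleftrightarrow>
        (AE x in \<mu>. (\<lambda>n. (1 / real n) * ln (f n x / exp (birkhoff_sum n h x))) \<longlonglongrightarrow> 0)"
    proof (rule AE_cong)
      fix x assume "x \<in> space \<mu>"
      then have x: "x \<in> X" using invariant_measureD(3)[OF erg_inv[OF \<mu>]] by simp
      \<comment> \<open>For \<open>n = 0\<close> both sides are 0 by the convention for division by
        zero, so the identity holds at every index.\<close>
      have eq: "g n x / n = (1 / real n) * ln (f n x / exp (birkhoff_sum n h x))" for n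
        using f(2)[OF _ x, of n] by (cases "n = 0") (auto simp: g_def ln_div)
      show "(\<lambda>n. g n x / n) \<longlonglongrightarrow> 0 \<longleftrightarrow>
          (\<lambda>n. (1 / real n) * ln (f n x / exp (birkhoff_sum n h x))) \<longlonglongrightarrow> 0"
        unfolding eq ..
    qed
    then show ?thesis
      using AE_lim_zero_iff_mean_lim_zero mean_iff[OF erg_inv[OF \<mu>]] by simp
  qed
  then have "cond_ii \<longleftrightarrow> cond_iii"
    unfolding cond_ii_def cond_iii_def by simp
  ultimately show ?thesis by blast
qed

end
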